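(* (Reconstruction theorem) Let $\mathbb V=\bigoplus_{n\in\mathbb N}\mathbb V(n)$ be a complex vector space graded by a diagonalizable operator $L_0$ (so $L_0|_{\mathbb V(n)}=n$), and let $\mathcal E$ be a set of $L_0$-homogeneous fields on $\mathbb V$. Assume: (1) Creation property: there is a distinguished vector $\mathbf 1\in\mathbb V(0)$ such that for every $A(z)\in\mathcal E$ the series $A(z)\mathbf 1$ has no negative powers of $z$. (2) Translation property: there is a distinguished $L_{-1}\in\mathrm{End}(\mathbb V)$ such that $L_{-1}\mathbf 1=0$ and $[L_{-1},A(z)]=\partial_zA(z)$ for each $A(z)\in\mathcal E$. (3) Generating property: the vectors $A^1_{n_1}\cdots A^k_{n_k}\mathbf 1$ (where $k\in\mathbb N$, $A^1(z),\dots,A^k(z)\in\mathcal E$, $n_1,\dots,n_k\in\mathbb Z$) span $\mathbb V$. (4) Locality: any two fields of $\mathcal E$ are local to each other. Then $\mathbb V$ has a unique graded vertex algebra structure (with grading operator $L_0$) such that each $A(z)\in\mathcal E$ is a vertex operator (i.e. is of the form $Y(u,z)$ for some $u\in\mathbb V$), and whose vacuum vector and translation operator are the given $\mathbf 1$ and $L_{-1}$. Moreover, if $L_0,L_{-1}$ can be extended to a sequence of operators $(L_n)_{n\in\mathbb Z}$ on $\mathbb V$ such that $\sum_{n\in\mathbb Z}L_nz^{-n-2}$ belongs to $\mathcal E$ and the Virasoro relation $[L_m,L_n]=(m-n)L_{m+n}+\frac{c}{12}(m+1)m(m-1)\delta_{m,-n}$ holds for some $c\in\mathbb C$, then $\mathbb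 V$ is a vertex operator algebra whose conformal vector $\mathbf c$ satisfies $Y(\mathbf c,z)=\sum_{n\in\mathbb Z}L_nz^{-n-2}$.
   Context: All vector spaces are over $\mathbb C$; $\mathbb N=\{0,1,2,\dots\}$. For a vector space $W$, $W[[z^{\pm1}]]$ is the space of formal series $\sum_{n\in\mathbb Z}w_nz^n$ with $w_n\in W$. Homogeneous field: $A(z)=\sum_{n\in\mathbb Z}A_nz^{-n-1}\in\mathrm{End}(\mathbb V)[[z^{\pm1}]]$ such that for some integer $\Delta_A$ (the weight) $[L_0,A(z)]=\Delta_A A(z)+z\partial_zA(z)$, equivalently $[L_0,A_n]=(\Delta_A-n-1)A_n$ for all $n$. Local (Lie algebraic version): $A(z)$ is local to $B(z)$ if there are $M\in\mathbb N$ and $C^0(z),\dots,C^{M-1}(z)\in\mathrm{End}(\mathbb V)[[z^{\pm1}]]$, $C^l(z)=\sum_nC^l_nz^{-n-1}$, with $[A_m,B_k]=\sum_{l=0}^{M-1}\binom ml C^l_{m+k-l}$ for all $m,k\in\mathbb Z$ (the sum is $0$ if $M=0$). This relation is symmetric in $A,B$. Graded vertex algebra: a vector space $\mathbb V$ with a diagonalizable $L_0$ with eigenvalues in $\mathbb N$ (grading $\mathbb V=\bigoplus_{n\in\mathbb N}\mathbb V(n)$; the $\mathbb V(n)$ need not be finite-dimensional) and a linear map $Y:\mathbb V\to\mathrm{End}(\mathbb V)[[z^{\pm1}]]$, $u\mapsto Y(u,z)=\sum_nY(u)_nz^{-n-1}$, such that: - there is $\mathbf 1\in\mathbb V(0)$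 (vacuum vector) with $Y(\mathbf 1,z)=\mathrm{id}$; - $Y(v)_{-1}\mathbf 1=v$ and $Y(v)_n\mathbf 1=0$ for $n>-1$ (creation property); - $[L_0,Y(v,z)]=Y(L_0v,z)+z\partial_zY(v,z)$ (grading property); - there is an operator $L_{-1}$ on $\mathbb V$ with $L_{-1}\mathbf 1=0$ and $[L_{-1},Y(v,z)]=\partial_zY(v,z)$ (translation property); - Jacobi identity: for all $u,v\in\mathbb V$ and $m,n,k\in\mathbb Z$, $$\sum_{l\in\mathbb N}\binom ml Y\big(Y(u)_{n+l}v\big)_{m+k-l}=\sum_{l\in\mathbb N}(-1)^l\binom nlY(u)_{m+n-l}Y(v)_{k+l}-\sum_{l\in\mathbb N}(-1)^{n+l}\binom nlY(v)_{n+k-l}Y(u)_{m+l}$$ (each sum is finite when applied to a vector). Vertex operator algebra (VOA): a graded vertex algebra such that $L_0,L_{-1}$ extend to operators $(L_n)_{n\in\mathbb Z}$ on $\mathbb V$ satisfying the Virasoro relation for some $c\in\mathbb C$, and such that there is a distinguished vector $\mathbf c\in\mathbb V$ (conformal vector) with $Y(\mathbf c)_n=L_{n-1}$ for all $n$, i.e. $Y(\mathbf c,z)=\sum_nL_nz^{-n-2}$. *)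

theory Defs
  imports Complex_Main "HOL-Library.Groups_Big_Fun"
begin

text \<open>
  A complex vector space is the whole type \<open>'v\<close> with a scalar multiplication \<open>scale\<close> satisfying
  \<^const>\<open>vector_space\<close>.  A formal series \<open>A(z) = \<Sum>\<^sub>n A\<^sub>n z\<^sup>-\<^sup>n\<^sup>-\<^sup>1\<close> in \<open>End(V)[[z\<^sup>\<plusminus>\<^sup>1]]\<close> is represented by its
  family of modes \<open>n \<mapsto> A\<^sub>n\<close>; so the entry at \<open>n\<close> is the coefficient of \<open>z\<^sup>-\<^sup>n\<^sup>-\<^sup>1\<close>, not of \<open>z\<^sup>n\<close>.
\<close>

type_synonym 'v formal_series = "int \<Rightarrow> 'v \<Rightarrow> 'v"

abbreviation endo :: "(complex \<Rightarrow> 'v \<Rightarrow> 'v) \<Rightarrow> ('v::ab_group_add \<Rightarrow> 'v) \<Rightarrow> bool"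
  where "endo scale f \<equiv> Vector_Spaces.linear scale scale f"

definition End_series :: "(complex \<Rightarrow> 'v \<Rightarrow> 'v) \<Rightarrow> 'v::ab_group_add formal_series set"
  where "End_series scale = {A. \<forall>n. endo scale (A n)}"

definition commutator :: "('v::ab_group_add \<Rightarrow> 'v) \<Rightarrow> ('v \<Rightarrow> 'v) \<Rightarrow> 'v \<Rightarrow> 'v"
  where "commutator f g v = f (g v) - g (f v)"

text \<open>
  \<open>\<partial>\<^sub>z A(z) = \<Sum>\<^sub>n (-n-1) A\<^sub>n z\<^sup>-\<^sup>n\<^sup>-\<^sup>2\<close>, so the coefficient of \<open>z\<^sup>-\<^sup>n\<^sup>-\<^sup>1\<close> is \<open>-n A\<^bsub>n-1\<^esub>\<close>;
  multiplication by \<open>z\<close> moves the mode \<open>n + 1\<close> to position \<open>n\<close>.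
\<close>

definition dz :: "(complex \<Rightarrow> 'v \<Rightarrow> 'v) \<Rightarrow> 'v formal_series \<Rightarrow> 'v formal_series"
  where "dz scale A n v = scale (- of_int n) (A (n - 1) v)"

definition times_z :: "'v formal_series \<Rightarrow> 'v formal_series"
  where "times_z A n = A (n + 1)"

definition diagonalizable :: "(complex \<Rightarrow> 'v \<Rightarrow> 'v) \<Rightarrow> ('v::ab_group_add \<Rightarrow> 'v) \<Rightarrow> bool"
  where "diagonalizable scale f \<longleftrightarrow>
    (\<exists>B. \<not> module.dependent scale B \<and> module.span scale B = UNIV \<and>
         (\<forall>b\<in>B. \<exists>a. f b = scale a b))"

definition grading_operator :: "(complex \<Rightarrow> 'v \<Rightarrow> 'v) \<Rightarrow> ('v::ab_group_add \<Rightarrow> 'v) \<Rightarrow> bool"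
  where "grading_operator scale L0 \<longleftrightarrow>
    endo scale L0 \<and> diagonalizable scale L0 \<and>
    (\<forall>a v. v \<noteq> 0 \<and> L0 v = scale a v \<longrightarrow> a \<in> \<nat>)"

definition homogeneous_component ::
  "(complex \<Rightarrow> 'v \<Rightarrow> 'v) \<Rightarrow> ('v \<Rightarrow> 'v) \<Rightarrow> nat \<Rightarrow> 'v set"
  where "homogeneous_component scale L0 n = {v. L0 v = scale (of_nat n) v}"

definition homogeneous_field ::
  "(complex \<Rightarrow> 'v \<Rightarrow> 'v) \<Rightarrow> ('v \<Rightarrow> 'v) \<Rightarrow> 'v::ab_group_add formal_series \<Rightarrow> bool"
  where "homogeneous_field scale L0 A \<longleftrightarrow>
    A \<in> End_series scale \<and>
    (\<exists>\<Delta>::int. \<forall>n v. commutator L0 (A n) v =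
                  scale (of_int \<Delta>) (A n v) + times_z (dz scale A) n v)"

definition local_fields ::
  "(complex \<Rightarrow> 'v \<Rightarrow> 'v) \<Rightarrow> 'v::ab_group_add formal_series \<Rightarrow> 'v formal_series \<Rightarrow> bool"
  where "local_fields scale A B \<longleftrightarrow>
    (\<exists>(M::nat) (C :: nat \<Rightarrow> 'v formal_series).
       (\<forall>l<M. C l \<in> End_series scale) \<and>
       (\<forall>m k v. commutator (A m) (B k) v =
          (\<Sum>l<M. scale (of_int m gchoose l) (C l (m + k - int l) v))))"

definition mode_monomials :: "'v formal_series set \<Rightarrow> 'v \<Rightarrow> 'v set"
  where "mode_monomials E vac =
    {foldr (\<lambda>(A, n) v. A n v) ps vac | ps. fst ` set ps \<subseteq> E}"

definition virasoro_relation ::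
  "(complex \<Rightarrow> 'v \<Rightarrow> 'v) \<Rightarrow> (int \<Rightarrow> 'v::ab_group_add \<Rightarrow> 'v) \<Rightarrow> complex \<Rightarrow> bool"
  where "virasoro_relation scale L c \<longleftrightarrow>
    (\<forall>m n v. commutator (L m) (L n) v =
       scale (of_int (m - n)) (L (m + n) v) +
       scale (if m = - n then c / 12 * of_int ((m + 1) * m * (m - 1)) else 0) v)"

text \<open>
  The sums over \<open>l \<in> \<nat>\<close> in the Jacobi identity are evaluated on a vector \<open>w\<close>.  Since
  \<^const>\<open>Sum_any\<close> is \<open>0\<close> on a family of infinite support, finiteness is required explicitly.
\<close>

definition jacobi_identity ::
  "(complex \<Rightarrow> 'v \<Rightarrow> 'v) \<Rightarrow> ('v::ab_group_add \<Rightarrow> 'v formal_series) \<Rightarrow> bool"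
  where "jacobi_identity scale Y \<longleftrightarrow>
    (\<forall>u v w (m::int) (n::int) (k::int).
      let p = (\<lambda>l::nat. scale (of_int m gchoose l)
                 (Y (Y u (n + int l) v) (m + k - int l) w));
          q = (\<lambda>l::nat. scale ((-1) ^ l * (of_int n gchoose l))
                 (Y u (m + n - int l) (Y v (k + int l) w)));
          r = (\<lambda>l::nat. scale ((-1) powi (n + int l) * (of_int n gchoose l))
                 (Y v (n + k - int l) (Y u (m + int l) w)))
      in finite {l. p l \<noteq> 0} \<and> finite {l. q l \<noteq> 0} \<and> finite {l. r l \<noteq> 0} \<and>
         Sum_any p = Sum_any q - Sum_any r)"

locale graded_vertex_algebra = vector_space scale
  for scale :: "complex \<Rightarrow> 'v::ab_group_add \<Rightarrow> 'v" +
  fixes L0 :: "'v \<Rightarrow> 'v"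
    and Y :: "'v \<Rightarrow> 'v formal_series"
    and vac :: 'v
    and T :: "'v \<Rightarrow> 'v"  \<comment> \<open>the translation operator \<open>L\<^bsub>-1\<^esub>\<close>\<close>
  assumes grading: "grading_operator scale L0"
    and Y_series: "Y v \<in> End_series scale"
    and Y_linear: "Vector_Spaces.linear scale scale (\<lambda>u. Y u n w)"
    and vac_degree: "vac \<in> homogeneous_component scale L0 0"
    and vac_field: "Y vac n w = (if n = - 1 then w else 0)"
    and creation: "Y v (- 1) vac = v"
    and creation_regular: "n > - 1 \<Longrightarrow> Y v n vac = 0"
    and grading_property:
      "commutator L0 (Y v n) w = Y (L0 v) n w + times_z (dz scale (Y v)) n w"
    and T_endo: "endo scale T"
    and T_vac: "T vac = 0"
    and translation: "commutator T (Y v n) w = dz scale (Y v) n w"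
    and jacobi: "jacobi_identity scale Y"

locale vertex_operator_algebra = graded_vertex_algebra scale L0 Y vac T
  for scale :: "complex \<Rightarrow> 'v::ab_group_add \<Rightarrow> 'v" and L0 Y vac T +
  fixes L :: "int \<Rightarrow> 'v \<Rightarrow> 'v"
    and c :: complex
    and conf :: 'v  \<comment> \<open>the conformal vector\<close>
  assumes L_endo: "endo scale (L n)"
    and L_zero: "L 0 = L0"
    and L_minus_one: "L (- 1) = T"
    and virasoro: "virasoro_relation scale L c"
    and conformal: "Y conf n = L (n - 1)"

end

theory Submission
  imports Defs
begin

text \<open>
  The fields in question are determined by their states.  Call \<open>A(z)\<close> a vertex field if it is
  truncated (\<open>A\<^sub>n v = 0\<close> for large \<open>n\<close>), creative (\<open>A\<^sub>n\<close> kills the vacuum for \<open>n \<ge> 0\<close>), translation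
  covariant, and local to every member of \<open>E\<close>.  Covariance makes \<open>A(z)\<^bold>1\<close> depend only on the state
  \<open>A\<^bsub>-1\<^esub>\<^bold>1\<close>, and locality then carries this from the vacuum to all monomials
  \<open>A\<^sup>1\<^bsub>n1\<^esub> \<dots> A\<^sup>k\<^bsub>nk\<^esub>\<^bold>1\<close>; so \<open>A \<mapsto> A\<^bsub>-1\<^esub>\<^bold>1\<close> is injective on vertex fields (\<open>vertex_field_eq_zero\<close>,
  Goddard's uniqueness).  It is surjective because vertex fields are closed under taking the
  \<open>n\<close>-th product \<open>A\<^bsub>(n)\<^esub>B\<close> with a member \<open>A\<close> of \<open>E\<close>, whose state is \<open>A\<^sub>n B\<^bsub>-1\<^esub>\<^bold>1\<close>; locality of the
  product is Dong's lemma (\<open>dong\<close>).  The inverse of this bijection is the map \<open>Y\<close>.  Building up states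
  from the vacuum and applying Dong's lemma again shows that all \<open>Y(u, z)\<close> are mutually local, and
  uniqueness gives \<open>Y(Y(u)\<^sub>n v) = Y(u)\<^bsub>(n)\<^esub>Y(v)\<close>, the case \<open>m = 0\<close> of the Jacobi identity.  Uniqueness of
  the vertex algebra structure follows from that case alone: it determines \<open>Y\<close> on monomials.
  Since every member of \<open>E\<close> is a value of \<open>Y\<close>, so is a Virasoro field in \<open>E\<close>, and its state is the
  conformal vector.

  No generating functions are used.  A bracket \<open>[A\<^sub>i, B\<^sub>k]v\<close> is viewed as a function of two integers, and
  multiplication by \<open>z - w\<close> becomes the difference operator \<open>f \<mapsto> f(i+1, k) - f(i, k+1)\<close>.  Locality says
  that a power of this operator kills the bracket.  The two infinite sums in the Jacobi identity are
  the coefficients of \<open>(z - w)\<^sup>n A(z) B(w)\<close> and \<open>(z - w)\<^sup>n B(w) A(z)\<close>, and raising \<open>n\<close> by one amounts to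
  applying the difference operator.  Since an operand that is annihilated by it and vanishes for
  all large \<open>k\<close> is zero, statements about such a family only have to be checked at \<open>n = 0\<close>
  (\<open>delta_family_zero\<close>).  This principle, in various guises, replaces all binomial identities except
  Pascal's rule: it yields covariance of products, the hypothesis of Dong's lemma, and, applied to
  the difference of the two sides, the Jacobi identity for all \<open>m\<close> from the case \<open>m = 0\<close>.
\<close>

section \<open>Difference operators on functions of integer indices\<close>

text \<open>
  If \<open>f i k\<close> is the coefficient of \<open>z\<^sup>-\<^sup>i\<^sup>-\<^sup>1 w\<^sup>-\<^sup>k\<^sup>-\<^sup>1\<close> in a series, then \<open>delta f\<close> holds the
  coefficients of its product with \<open>z - w\<close>.
\<close>

definition delta :: "(int \<Rightarrow> int \<Rightarrow> 'v::ab_group_add) \<Rightarrow> int \<Rightarrow> int \<Rightarrow> 'v"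
  where "delta f i k = f (i + 1) k - f i (k + 1)"

lemma delta_pow_Suc: "(delta ^^ Suc N) f i k = (delta ^^ N) f (i + 1) k - (delta ^^ N) f i (k + 1)"
  by (simp add: delta_def)

lemma delta_pow_zero [simp]: "(delta ^^ N) (\<lambda>i k. 0) = (\<lambda>i k. 0)"
  by (induction N) (auto simp: delta_def fun_eq_iff)

lemma delta_pow_add:
  "(delta ^^ N) (\<lambda>i k. f i k + g i k) = (\<lambda>i k. (delta ^^ N) f i k + (delta ^^ N) g i k)"
  by (induction N) (auto simp: delta_def fun_eq_iff)

lemma delta_pow_mono:
  assumes "(delta ^^ N) f = (\<lambda>i k. 0)" and "N \<le> M"
  shows "(delta ^^ M) f = (\<lambda>i k. 0)"
proof -
  obtain d where "M = d + N" using assms(2) by (metis le_add_diff_inverse2)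
  then show ?thesis using assms(1) by (simp add: funpow_add)
qed

text \<open>
  The operator stays within the antidiagonals \<open>i + k = s\<close>, moving from \<open>s + 1\<close> to \<open>s\<close>; hence it
  commutes with any additive map that depends on the index only through \<open>s\<close>, up to a shift of \<open>s\<close>.
\<close>
lemma delta_pow_map:
  assumes "\<And>s x y. h s (x - y) = h s x - h s y"
  shows "(delta ^^ N) (\<lambda>i k. h (i + k) (f i k)) = (\<lambda>i k. h (i + k + int N) ((delta ^^ N) f i k))"
proof (induction N)
  case (Suc N)
  show ?case
    by (intro ext) (simp only: delta_pow_Suc Suc.IH assms, simp add: algebra_simps)
qed simp

lemma delta_pow_swap:
  assumes "(delta ^^ N) f = (\<lambda>i k. 0)"
  shows "(delta ^^ N) (\<lambda>i k. f k i) = (\<lambda>i k. 0)"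
proof -
  have "(delta ^^ N) (\<lambda>i k. f k i) i k =
      (if even N then (delta ^^ N) f k i else - (delta ^^ N) f k i)" for N i k
  proof (induction N arbitrary: i k)
    case (Suc N)
    show ?case by (simp only: delta_pow_Suc Suc.IH) simp
  qed simp
  then show ?thesis by (simp add: assms fun_eq_iff)
qed

text \<open>
  A function killed by \<^const>\<open>delta\<close> is constant along every antidiagonal, and every antidiagonal
  reaches the region \<open>k \<ge> K\<close>.
\<close>
lemma zero_if_delta_zero:
  assumes d: "delta f = (\<lambda>i k. 0)" and K: "\<And>i k. k \<ge> K \<Longrightarrow> f i k = 0"
  shows "f = (\<lambda>i k. 0)"
proof -
  have step: "f i k = f (i - 1) (k + 1)" for i k
    using fun_cong [OF fun_cong [OF d], of "i - 1" k] by (simp add: delta_def)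
  have iter: "f i k = f (i - int j) (k + int j)" for i k j
  proof (induction j)
    case (Suc j)
    then show ?case using step [of "i - int j" "k + int j"] by (simp add: algebra_simps)
  qed simp
  have "f i k = f (i - int (nat (K - k))) (k + int (nat (K - k)))" for i k
    by (rule iter)
  then show ?thesis using K by fastforce
qed

lemma zero_if_delta_pow_zero:
  assumes "(delta ^^ N) f = (\<lambda>i k. 0)" and K: "\<And>i k. k \<ge> K \<Longrightarrow> f i k = 0"
  shows "f = (\<lambda>i k. 0)"
  using assms
proof (induction N arbitrary: f)
  case (Suc N)
  have "delta f = (\<lambda>i k. 0)"
  proof (rule Suc.IH)
    show "(delta ^^ N) (delta f) = (\<lambda>i k. 0)"
      using Suc.prems(1) by (simp add: funpow_swap1)
  qed (simp add: delta_def Suc.prems(2))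
  then show ?case using Suc.prems(2) by (rule zero_if_delta_zero)
qed simp

text \<open>
  Upwards from \<open>n = 0\<close> the recursion gives the claim at once; downwards it says that \<open>F (n - 1)\<close> is
  killed by \<^const>\<open>delta\<close>, and multiplication by \<open>z - w\<close> is injective on functions that vanish for
  large \<open>k\<close>.
\<close>
lemma delta_family_zero:
  fixes F :: "int \<Rightarrow> int \<Rightarrow> int \<Rightarrow> 'v::ab_group_add"
  assumes rec: "\<And>n. F (n + 1) = delta (F n)"
    and zero: "F 0 = (\<lambda>i k. 0)"
    and van: "\<And>n. \<exists>K. \<forall>i k. k \<ge> K \<longrightarrow> F n i k = 0"
  shows "F n i k = 0"
proof -
  have "F n = (\<lambda>i k. 0)"
  proof (induction n rule: int_induct [where k = 0])
    case (step1 i)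
    then show ?case by (auto simp: rec delta_def)
  next
    case (step2 i)
    then have "delta (F (i - 1)) = (\<lambda>i k. 0)" using rec [of "i - 1"] by simp
    then show ?case using van [of "i - 1"] by (metis zero_if_delta_zero)
  qed (rule zero)
  then show ?thesis by simp
qed

text \<open>
  Three-variable versions, for coefficients of \<open>u\<^sup>-\<^sup>m\<^sup>-\<^sup>1 z\<^sup>-\<^sup>i\<^sup>-\<^sup>1 w\<^sup>-\<^sup>k\<^sup>-\<^sup>1\<close>: multiplication by
  \<open>u - z\<close>, \<open>u - w\<close> and \<open>z - w\<close>.
\<close>
definition delta_uz :: "(int \<Rightarrow> int \<Rightarrow> int \<Rightarrow> 'v::ab_group_add) \<Rightarrow> int \<Rightarrow> int \<Rightarrow> int \<Rightarrow> 'v"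
  where "delta_uz f m i k = f (m + 1) i k - f m (i + 1) k"

definition delta_uw :: "(int \<Rightarrow> int \<Rightarrow> int \<Rightarrow> 'v::ab_group_add) \<Rightarrow> int \<Rightarrow> int \<Rightarrow> int \<Rightarrow> 'v"
  where "delta_uw f m i k = f (m + 1) i k - f m i (k + 1)"

definition delta_zw :: "(int \<Rightarrow> int \<Rightarrow> int \<Rightarrow> 'v::ab_group_add) \<Rightarrow> int \<Rightarrow> int \<Rightarrow> int \<Rightarrow> 'v"
  where "delta_zw f m = delta (f m)"

abbreviation zero3 :: "int \<Rightarrow> int \<Rightarrow> int \<Rightarrow> 'v::ab_group_add"
  where "zero3 \<equiv> (\<lambda>m i k. 0)"

lemma delta3_zero [simp]:
  "(delta_uz ^^ N) zero3 = zero3" "(delta_uw ^^ N) zero3 = zero3" "(delta_zw ^^ N) zero3 = zero3"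
  by (induction N; auto simp: delta_uz_def delta_uw_def delta_zw_def delta_def fun_eq_iff)+

lemma delta3_pow_Suc:
  "(delta_uz ^^ Suc N) f m i k = (delta_uz ^^ N) f (m + 1) i k - (delta_uz ^^ N) f m (i + 1) k"
  "(delta_uw ^^ Suc N) f m i k = (delta_uw ^^ N) f (m + 1) i k - (delta_uw ^^ N) f m i (k + 1)"
  by (simp_all add: delta_uz_def delta_uw_def)

lemma delta3_add:
  "(delta_uz ^^ N) (\<lambda>m i k. f m i k + g m i k) =
     (\<lambda>m i k. (delta_uz ^^ N) f m i k + (delta_uz ^^ N) g m i k)"
  "(delta_uw ^^ N) (\<lambda>m i k. f m i k + g m i k) =
     (\<lambda>m i k. (delta_uw ^^ N) f m i k + (delta_uw ^^ N) g m i k)"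
  by (induction N; auto simp: delta_uz_def delta_uw_def fun_eq_iff)+

lemma delta3_commute:
  "(delta_uz ^^ a) ((delta_uw ^^ b) f) = (delta_uw ^^ b) ((delta_uz ^^ a) f)"
  "(delta_uz ^^ a) ((delta_zw ^^ b) f) = (delta_zw ^^ b) ((delta_uz ^^ a) f)"
  "(delta_uw ^^ a) ((delta_zw ^^ b) f) = (delta_zw ^^ b) ((delta_uw ^^ a) f)"
proof -
  have c: "(p ^^ a) ((q ^^ b) f) = (q ^^ b) ((p ^^ a) f)"
    if "\<And>f. p (q f) = q (p f)" for p q :: "'b \<Rightarrow> 'b" and f
  proof -
    have 1: "p ((q ^^ b) f) = (q ^^ b) (p f)" for f by (induction b) (auto simp: that)
    show ?thesis by (induction a) (auto simp: 1)
  qed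
  show "(delta_uz ^^ a) ((delta_uw ^^ b) f) = (delta_uw ^^ b) ((delta_uz ^^ a) f)"
    "(delta_uz ^^ a) ((delta_zw ^^ b) f) = (delta_zw ^^ b) ((delta_uz ^^ a) f)"
    "(delta_uw ^^ a) ((delta_zw ^^ b) f) = (delta_zw ^^ b) ((delta_uw ^^ a) f)"
    by (rule c; auto simp: delta_uz_def delta_uw_def delta_zw_def delta_def fun_eq_iff)+
qed

lemmas delta3_commute_once =
  delta3_commute(2) [where b = 1, simplified]
  delta3_commute(3) [where b = 1, simplified]
  delta3_commute(2) [where a = 1, simplified]

lemma delta_uz_pow: "(delta_uz ^^ N) f m i k = (delta ^^ N) (\<lambda>m i. f m i k) m i"
  by (induction N arbitrary: m i) (auto simp: delta_uz_def delta_def)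

lemma delta_uw_pow: "(delta_uw ^^ N) f m i k = (delta ^^ N) (\<lambda>m k. f m i k) m k"
  by (induction N arbitrary: m k) (auto simp: delta_uw_def delta_def)

lemma delta_uz_pow_swap:
  "(delta_uz ^^ N) (\<lambda>m i k. f m k i) = (\<lambda>m i k. (delta_uw ^^ N) f m k i)"
  by (induction N) (auto simp: delta_uz_def delta_uw_def fun_eq_iff)

lemma delta_uw_pow_swap:
  "(delta_uw ^^ N) (\<lambda>m i k. f m k i) = (\<lambda>m i k. (delta_uz ^^ N) f m k i)"
  by (induction N) (auto simp: delta_uz_def delta_uw_def fun_eq_iff)

text \<open>
  As \<open>u - w = (u - z) + (z - w)\<close>, every term in the expansion of \<open>(u - w)\<^sup>a\<^sup>+\<^sup>b\<close> contains
  \<open>(u - z)\<^sup>a\<close> or \<open>(z - w)\<^sup>b\<close>.  Peeling off one factor at a time avoids the binomial expansion.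
\<close>
lemma delta_uw_pow_zero:
  assumes "(delta_uz ^^ a) f = zero3" and "(delta_zw ^^ b) f = zero3"
  shows "(delta_uw ^^ (a + b)) f = zero3"
  using assms
proof (induction "a + b" arbitrary: a b f)
  case (Suc s)
  show ?case
  proof (cases "a = 0 \<or> b = 0")
    case True
    then have "f = zero3" using Suc.prems by auto
    then show ?thesis by simp
  next
    case False
    then obtain a' b' where ab: "a = Suc a'" "b = Suc b'" by (meson not0_implies_Suc)
    have split: "delta_uw f = (\<lambda>m i k. delta_uz f m i k + delta_zw f m i k)"
      by (auto simp: delta_uw_def delta_uz_def delta_zw_def delta_def fun_eq_iff)
    have c1: "(delta_zw ^^ b) (delta_uz f) = zero3"
      using Suc.prems(2) delta3_zero(1) [of 1] by (simp flip: delta3_commute_once(3))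
    have c2: "(delta_uz ^^ a) (delta_zw f) = zero3"
      using Suc.prems(1) delta3_zero(3) [of 1] by (simp add: delta3_commute_once)
    have "(delta_uw ^^ (a' + b)) (delta_uz f) = zero3"
      by (rule Suc.hyps(1)) (use Suc c1 ab in \<open>auto simp: funpow_swap1\<close>)
    moreover have "(delta_uw ^^ (a + b')) (delta_zw f) = zero3"
      by (rule Suc.hyps(1)) (use Suc c2 ab in \<open>auto simp: funpow_swap1\<close>)
    moreover have "a + b' = a' + b" by (simp add: ab)
    moreover have "(delta_uw ^^ (a + b)) f = (delta_uw ^^ (a' + b)) (delta_uw f)"
      by (simp add: ab funpow_swap1)
    ultimately show ?thesis
      unfolding split by (simp only: delta3_add) simp
  qed
qed simp

text \<open>
  The principle of \<open>delta_family_zero\<close> after multiplication by \<open>(u - z)\<^sup>a (u - w)\<^sup>b\<close>.  The bound in the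
  vanishing hypothesis may depend on \<open>m\<close>, because these operators involve only finitely many \<open>m\<close>.
\<close>
lemma delta3_family_zero:
  fixes F :: "int \<Rightarrow> int \<Rightarrow> int \<Rightarrow> int \<Rightarrow> 'v::ab_group_add"
  assumes rec: "\<And>n. F (n + 1) = delta_zw (F n)"
    and zero: "(delta_uz ^^ a) ((delta_uw ^^ b) (F 0)) = zero3"
    and van: "\<And>n m. \<exists>K. \<forall>i k. k \<ge> K \<longrightarrow> F n m i k = 0"
  shows "(delta_uz ^^ a) ((delta_uw ^^ b) (F n)) = zero3"
proof -
  define X where "X n = (delta_uz ^^ a) ((delta_uw ^^ b) (F n))" for n
  have recX: "X (n + 1) = delta_zw (X n)" for n
    unfolding X_def rec by (simp add: delta3_commute_once)
  have vuw: "\<exists>K. \<forall>i k. k \<ge> K \<longrightarrow> (delta_uw ^^ b) (F n) m i k = 0" for m n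
  proof (induction b arbitrary: m)
    case (Suc b)
    obtain K1 K2 where "\<forall>i k. k \<ge> K1 \<longrightarrow> (delta_uw ^^ b) (F n) m i k = 0"
      "\<forall>i k. k \<ge> K2 \<longrightarrow> (delta_uw ^^ b) (F n) (m + 1) i k = 0"
      using Suc by meson
    then show ?case
      by (intro exI [of _ "max K1 K2"]) (auto simp: delta3_pow_Suc simp del: funpow.simps)
  qed (simp add: van)
  have vX: "\<exists>K. \<forall>i k. k \<ge> K \<longrightarrow> X n m i k = 0" for m n
    unfolding X_def
  proof (induction a arbitrary: m)
    case (Suc a)
    let ?G = "(delta_uz ^^ a) ((delta_uw ^^ b) (F n))"
    obtain K1 K2 where "\<forall>i k. k \<ge> K1 \<longrightarrow> ?G m i k = 0" "\<forall>i k. k \<ge> K2 \<longrightarrow> ?G (m + 1) i k = 0"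
      using Suc by meson
    then show ?case
      by (intro exI [of _ "max K1 K2"]) (auto simp: delta3_pow_Suc simp del: funpow.simps)
  qed (simp add: vuw)
  have "X n m i k = 0" for m i k
    by (rule delta_family_zero [of "\<lambda>n. X n m"])
      (auto simp: recX delta_zw_def vX, simp add: X_def zero)
  then show ?thesis by (simp add: X_def fun_eq_iff)
qed


section \<open>Fields and their residue products\<close>

locale complex_vector_space = vector_space scale
  for scale :: "complex \<Rightarrow> 'v::ab_group_add \<Rightarrow> 'v"
begin

lemma endo_iff:
  "endo scale f \<longleftrightarrow> (\<forall>x y. f (x + y) = f x + f y) \<and> (\<forall>a x. f (scale a x) = scale a (f x))"
  using module_hom_iff_linear [of scale scale f] module_axioms
  by (auto simp: module_hom_def module_hom_axioms_def)

lemma endo_add: "endo scale f \<Longrightarrow> f (x + y) = f x + f y"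
  and endo_scale: "endo scale f \<Longrightarrow> f (scale a x) = scale a (f x)"
  by (auto simp: endo_iff)

lemma endo_zero: "endo scale f \<Longrightarrow> f 0 = 0"
  using endo_scale [of f 0 0] by simp

lemma endo_diff: "endo scale f \<Longrightarrow> f (x - y) = f x - f y"
  by (metis add_diff_cancel_right' diff_add_cancel endo_add)

lemma endo_Sum_any:
  assumes f: "endo scale f" and fin: "finite {l. g l \<noteq> 0}"
  shows "f (Sum_any g) = Sum_any (\<lambda>l. f (g l))"
proof -
  have "Sum_any (\<lambda>l. f (g l)) = sum (\<lambda>l. f (g l)) {l. g l \<noteq> 0}"
    by (rule Sum_any.expand_superset) (use fin endo_zero [OF f] in auto)
  moreover have "f (sum g S) = sum (\<lambda>l. f (g l)) S" if "finite S" for S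
    using that by (induction S) (auto simp: endo_zero [OF f] endo_add [OF f])
  ultimately show ?thesis using fin by (simp add: Sum_any.expand_set)
qed

lemma EndD: "A \<in> End_series scale \<Longrightarrow> endo scale (A n)"
  by (simp add: End_series_def)

lemmas End_simps = EndD [THEN endo_add] EndD [THEN endo_scale] EndD [THEN endo_zero]
  EndD [THEN endo_diff]

definition truncated :: "'v formal_series \<Rightarrow> bool"
  where "truncated A \<longleftrightarrow> (\<forall>v. \<exists>N. \<forall>n\<ge>N. A n v = 0)"

lemma truncatedD: "truncated A \<Longrightarrow> \<exists>N. \<forall>n\<ge>N. A n v = 0"
  by (simp add: truncated_def)

lemma finite_int_shift:
  assumes "\<And>n. n \<ge> N \<Longrightarrow> f n = 0" and "\<And>l. f (k + int l) = 0 \<Longrightarrow> g l = 0"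
  shows "finite {l. g l \<noteq> (0::'v)}"
proof (rule finite_subset)
  show "{l. g l \<noteq> 0} \<subseteq> {..<nat (N - k)}"
  proof
    fix l assume "l \<in> {l. g l \<noteq> 0}"
    then have "\<not> k + int l \<ge> N" using assms by blast
    then show "l \<in> {..<nat (N - k)}" by auto
  qed
qed simp

text \<open>The shape in which Pascal's rule enters: the second summand is delayed by one index.\<close>
lemma Sum_any_shift:
  fixes a b t :: "nat \<Rightarrow> 'v"
  assumes fin: "finite {l. a l \<noteq> 0}" "finite {l. b l \<noteq> 0}"
    and "t 0 = a 0" and "\<And>l. t (Suc l) = a (Suc l) + b l"
  shows "Sum_any t = Sum_any a + Sum_any b"
proof -
  have "finite ({l. a l \<noteq> 0} \<union> {l. b l \<noteq> 0})" using fin by blast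
  then obtain N where N: "{l. a l \<noteq> 0} \<union> {l. b l \<noteq> 0} \<subseteq> {..<N}"
    by (metis finite_nat_set_iff_bounded lessThan_iff subsetI)
  have t: "{l. t l \<noteq> 0} \<subseteq> {..<Suc N}"
  proof
    fix l assume "l \<in> {l. t l \<noteq> 0}"
    then have "a l \<noteq> 0 \<or> (\<exists>l'. l = Suc l' \<and> b l' \<noteq> 0)"
      using assms(3,4) by (cases l) auto
    then show "l \<in> {..<Suc N}" using N by auto
  qed
  have "Sum_any t = sum t {..<Suc N}"
    by (rule Sum_any.expand_superset) (use t in auto)
  also have "\<dots> = a 0 + (\<Sum>l<N. a (Suc l)) + (\<Sum>l<N. b l)"
    by (simp add: sum.lessThan_Suc_shift assms(3,4) sum.distrib add.assoc del: sum.lessThan_Suc)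
  also have "\<dots> = sum a {..<Suc N} + sum b {..<N}"
    by (simp add: sum.lessThan_Suc_shift del: sum.lessThan_Suc)
  also have "\<dots> = Sum_any a + Sum_any b"
    using Sum_any.expand_superset [of "{..<Suc N}" a] Sum_any.expand_superset [of "{..<N}" b] N
    by (simp add: subset_iff less_Suc_eq)
  finally show ?thesis .
qed

lemma Sum_any_only_0:
  fixes g :: "nat \<Rightarrow> 'v"
  assumes "\<And>l. g (Suc l) = 0"
  shows "Sum_any g = g 0"
proof -
  have "{l. g l \<noteq> 0} \<subseteq> {0}"
  proof
    fix l assume "l \<in> {l. g l \<noteq> 0}"
    then show "l \<in> {0}" using assms by (cases l) auto
  qed
  then show ?thesis using Sum_any.expand_superset [of "{0}" g] by simp
qed
text \<open>
  The coefficients of \<open>(z - w)\<^sup>n A(z) B(w) v\<close>, where \<open>(z - w)\<^sup>n\<close> is expanded in \<open>\<bar>z\<bar> > \<bar>w\<bar>\<close>.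
\<close>
definition ordered_product ::
  "'v formal_series \<Rightarrow> 'v formal_series \<Rightarrow> 'v \<Rightarrow> int \<Rightarrow> int \<Rightarrow> int \<Rightarrow> 'v"
  where "ordered_product A B v n i k =
    Sum_any (\<lambda>l::nat. scale ((-1) ^ l * (of_int n gchoose l)) (A (i + n - int l) (B (k + int l) v)))"

text \<open>
  The coefficients and outer modes are arbitrary, so that the lemma applies to each of the sums
  over modes of \<open>B\<close> that occur below.
\<close>
lemma ordered_product_finite:
  assumes "A \<in> End_series scale" and "truncated B"
  shows "finite {l::nat. scale (c l) (A (d l) (B (k + int l) v)) \<noteq> 0}"
proof -
  obtain N where "\<And>n. n \<ge> N \<Longrightarrow> B n v = 0" using truncatedD [OF assms(2)] by metis
  then show ?thesis
    by (rule finite_int_shift [where f = "\<lambda>n. B n v" and k = k]) (auto simp: End_simps assms(1))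
qed

lemma ordered_product_0: "ordered_product A B v 0 i k = A i (B k v)"
  unfolding ordered_product_def by (subst Sum_any_only_0) auto

lemma ordered_product_Suc:
  assumes A: "A \<in> End_series scale" and B: "truncated B"
  shows "ordered_product A B v (n + 1) = delta (ordered_product A B v n)"
proof (intro ext)
  fix i k
  let ?c = "\<lambda>n l. (-1) ^ l * (complex_of_int n gchoose l)"
  have "ordered_product A B v (n + 1) i k =
      ordered_product A B v n (i + 1) k +
      Sum_any (\<lambda>l. scale (- ?c n l) (A (i + n - int l) (B (k + 1 + int l) v)))"
    unfolding ordered_product_def
  proof (rule Sum_any_shift)
    fix l
    show "scale (?c (n + 1) (Suc l)) (A (i + (n + 1) - int (Suc l)) (B (k + int (Suc l)) v)) =
      scale (?c n (Suc l)) (A (i + 1 + n - int (Suc l)) (B (k + int (Suc l)) v)) +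
      scale (- ?c n l) (A (i + n - int l) (B (k + 1 + int l) v))"
    proof -
      have "complex_of_int (n + 1) gchoose Suc l = (of_int n gchoose l) + (of_int n gchoose Suc l)"
        by (simp add: gbinomial_Suc_Suc)
      then have c: "?c (n + 1) (Suc l) = ?c n (Suc l) + - ?c n l"
        by (simp add: distrib_left)
      have ix: "i + (n + 1) - int (Suc l) = i + n - int l" "i + 1 + n - int (Suc l) = i + n - int l"
        "k + 1 + int l = k + int (Suc l)"
        by simp_all
      show ?thesis unfolding ix c by (rule scale_left_distrib)
    qed
  qed ((rule ordered_product_finite [OF assms])+, simp add: algebra_simps)
  also have "Sum_any (\<lambda>l. scale (- ?c n l) (A (i + n - int l) (B (k + 1 + int l) v))) =
      - ordered_product A B v n i (k + 1)"
  proof -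
    have "endo scale uminus" by (simp add: endo_iff)
    from endo_Sum_any [OF this ordered_product_finite [OF assms]] show ?thesis
      by (simp add: ordered_product_def)
  qed
  finally show "ordered_product A B v (n + 1) i k = delta (ordered_product A B v n) i k"
    by (simp add: delta_def)
qed

lemma ordered_product_vanishes:
  assumes "A \<in> End_series scale" and "\<And>n. n \<ge> K \<Longrightarrow> B n v = 0" and "k \<ge> K"
  shows "ordered_product A B v n i k = 0"
  using assms by (simp add: ordered_product_def End_simps)

lemma ordered_product_bound:
  assumes "A \<in> End_series scale" and "truncated B"
  shows "\<exists>K. \<forall>i k. k \<ge> K \<longrightarrow> ordered_product A B v n i k = 0"
  using assms truncatedD [of B v] by (metis ordered_product_vanishes)

lemma ordered_product_add:
  assumes A: "A \<in> End_series scale" and B: "B \<in> End_series scale" "truncated B"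
  shows "ordered_product A B (v + w) n i k = ordered_product A B v n i k + ordered_product A B w n i k"
  unfolding ordered_product_def
  by (subst Sum_any.distrib [OF ordered_product_finite ordered_product_finite, symmetric])
    (simp_all add: assms End_simps scale_right_distrib)

lemma ordered_product_scale:
  assumes A: "A \<in> End_series scale" and B: "B \<in> End_series scale" "truncated B"
  shows "ordered_product A B (scale a v) n i k = scale a (ordered_product A B v n i k)"
proof -
  have "endo scale (scale a)" by (simp add: endo_iff scale_right_distrib)
  from endo_Sum_any [OF this ordered_product_finite [OF A B(2)]] show ?thesis
    by (simp add: ordered_product_def End_simps assms mult.commute)
qed

text \<open>
  For fixed \<open>k\<close> only finitely many of the vectors \<open>B\<^bsub>k+l\<^esub>v\<close> are nonzero, so one bound serves all of
  them.  This controls the term \<open>B(w) A(z)\<close> in an \<open>n\<close>-th product.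
\<close>
lemma ordered_product_bound_left:
  assumes A: "A \<in> End_series scale" "truncated A" and B: "truncated B"
  shows "\<exists>I. \<forall>i\<ge>I. ordered_product A B v n i k = 0"
proof -
  obtain K where K: "\<And>k. k \<ge> K \<Longrightarrow> B k v = 0" using truncatedD [OF B] by metis
  define L where "L = nat (K - k)"
  have "\<exists>I. \<forall>l<L. \<forall>i\<ge>I. A (i + n - int l) (B (k + int l) v) = 0"
  proof (induction L)
    case (Suc L)
    then obtain I where I: "\<forall>l<L. \<forall>i\<ge>I. A (i + n - int l) (B (k + int l) v) = 0" by blast
    obtain J where "\<forall>j\<ge>J. A j (B (k + int L) v) = 0" using truncatedD [OF A(2)] by blast
    then have "\<forall>l<Suc L. \<forall>i\<ge>max I (J - n + int L). A (i + n - int l) (B (k + int l) v) = 0"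
      using I by (auto simp: less_Suc_eq)
    then show ?case by blast
  qed simp
  then obtain I where I: "\<And>l i. l < L \<Longrightarrow> i \<ge> I \<Longrightarrow> A (i + n - int l) (B (k + int l) v) = 0"
    by blast
  have "A (i + n - int l) (B (k + int l) v) = 0" if "i \<ge> I" for i l
  proof (cases "l < L")
    case False
    then have "k + int l \<ge> K" by (simp add: L_def)
    then show ?thesis by (simp add: K End_simps A)
  qed (simp add: I that)
  then show ?thesis by (intro exI [of _ I]) (simp add: ordered_product_def)
qed

definition covariant :: "('v \<Rightarrow> 'v) \<Rightarrow> 'v formal_series \<Rightarrow> bool"
  where "covariant T A \<longleftrightarrow> (\<forall>n v. commutator T (A n) v = dz scale A n v)"

lemma covariantD: "covariant T A \<Longrightarrow> T (A n v) = A n (T v) - scale (of_int n) (A (n - 1) v)"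
  by (simp add: covariant_def commutator_def dz_def algebra_simps)

text \<open>
  Integration by parts: \<open>[T, A(z) B(w)] = (\<partial>\<^sub>z + \<partial>\<^sub>w) A(z) B(w)\<close>, and \<open>\<partial>\<^sub>z + \<partial>\<^sub>w\<close> kills
  \<open>(z - w)\<^sup>n\<close>.  In modes, the difference \<open>X\<close> of the two sides obeys the recursion in \<open>n\<close>, so only
  \<open>n = 0\<close> has to be computed.
\<close>
lemma ordered_product_covariant:
  assumes A: "A \<in> End_series scale" "covariant T A"
    and B: "truncated B" "covariant T B"
    and T: "endo scale T"
  shows "T (ordered_product A B v n i k) = ordered_product A B (T v) n i k
    - scale (of_int i) (ordered_product A B v n (i - 1) k)
    - scale (of_int k) (ordered_product A B v n i (k - 1))"
proof -
  let ?q = "ordered_product A B v" and ?q' = "ordered_product A B (T v)"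
  define X where "X n i k = T (?q n i k) - ?q' n i k
    + scale (of_int i) (?q n (i - 1) k) + scale (of_int k) (?q n i (k - 1))" for n i k
  have "X n i k = 0"
  proof (rule delta_family_zero)
    show "X (n + 1) = delta (X n)" for n
      by (intro ext, simp only: delta_def X_def ordered_product_Suc [OF A(1) B(1)])
        (simp add: endo_diff [OF T] algebra_simps scale_left_distrib)
    show "X 0 = (\<lambda>i k. 0)"
      by (intro ext) (simp add: X_def ordered_product_0 covariantD [OF A(2)] covariantD [OF B(2)]
          End_simps A(1))
    show "\<exists>K. \<forall>i k. k \<ge> K \<longrightarrow> X n i k = 0" for n
    proof -
      obtain K K' where "\<forall>i k. k \<ge> K \<longrightarrow> ?q n i k = 0" "\<forall>i k. k \<ge> K' \<longrightarrow> ?q' n i k = 0"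
        using ordered_product_bound [OF A(1) B(1)] by metis
      then show ?thesis
        by (intro exI [of _ "max (K + 1) K'"]) (auto simp: X_def endo_zero [OF T])
    qed
  qed
  then show ?thesis by (simp add: X_def algebra_simps eq_neg_iff_add_eq_0)
qed

text \<open>
  The right-hand side of the Jacobi identity, with \<open>i\<close> in the place of \<open>m\<close>: the residue in \<open>z\<close> and \<open>w\<close>
  of \<open>z\<^sup>i w\<^sup>k (z - w)\<^sup>n [A(z), B(w)]v\<close>, where \<open>(z - w)\<^sup>n\<close> is expanded in \<open>\<bar>z\<bar> > \<bar>w\<bar>\<close> in front of
  \<open>A(z) B(w)\<close> and in \<open>\<bar>w\<bar> > \<bar>z\<bar>\<close> in front of \<open>B(w) A(z)\<close>.
\<close>
definition residue_product ::
  "'v formal_series \<Rightarrow> 'v formal_series \<Rightarrow> 'v \<Rightarrow> int \<Rightarrow> int \<Rightarrow> int \<Rightarrow> 'v"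
  where "residue_product A B v n i k =
    ordered_product A B v n i k - scale ((-1) powi n) (ordered_product B A v n k i)"

definition nth_product :: "'v formal_series \<Rightarrow> int \<Rightarrow> 'v formal_series \<Rightarrow> 'v formal_series"
  where "nth_product A n B k v = residue_product A B v n 0 k"

lemma residue_product_0: "residue_product A B v 0 i k = commutator (A i) (B k) v"
  by (simp add: residue_product_def ordered_product_0 commutator_def)

lemma residue_product_Suc:
  assumes "A \<in> End_series scale" "truncated A" "B \<in> End_series scale" "truncated B"
  shows "residue_product A B v (n + 1) = delta (residue_product A B v n)"
proof -
  have "(- 1 :: complex) powi (n + 1) = - ((-1) powi n)" by (simp add: power_int_add_1)
  then show ?thesis
    by (intro ext, simp only: delta_def residue_product_def ordered_product_Suc assms)
      (simp add: algebra_simps)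
qed

lemma nth_product_End:
  assumes "A \<in> End_series scale" "truncated A" "B \<in> End_series scale" "truncated B"
  shows "nth_product A n B \<in> End_series scale"
  unfolding End_series_def mem_Collect_eq endo_iff nth_product_def residue_product_def
  by (simp add: assms ordered_product_add ordered_product_scale algebra_simps)

lemma nth_product_truncated:
  assumes "A \<in> End_series scale" "truncated A" "B \<in> End_series scale" "truncated B"
  shows "truncated (nth_product A n B)"
  unfolding truncated_def
proof
  fix v
  obtain K where "\<forall>i k. k \<ge> K \<longrightarrow> ordered_product A B v n i k = 0"
    using ordered_product_bound [OF assms(1,4)] by blast
  moreover obtain I where "\<forall>i\<ge>I. ordered_product B A v n i 0 = 0"
    using ordered_product_bound_left [OF assms(3,4,2)] by blast
  ultimately show "\<exists>N. \<forall>k\<ge>N. nth_product A n B k v = 0"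
    by (intro exI [of _ "max K I"]) (simp add: nth_product_def residue_product_def)
qed

lemma nth_product_covariant:
  assumes "A \<in> End_series scale" "truncated A" "B \<in> End_series scale" "truncated B"
    and "covariant T A" "covariant T B" "endo scale T"
  shows "covariant T (nth_product A n B)"
  unfolding covariant_def [of _ "nth_product A n B"] commutator_def dz_def nth_product_def
    residue_product_def
  by (simp add: assms endo_diff endo_scale ordered_product_covariant algebra_simps)

lemma nth_product_vac:
  assumes A: "A \<in> End_series scale" "\<And>n. n \<ge> 0 \<Longrightarrow> A n vac = 0"
    and B: "B \<in> End_series scale" "\<And>n. n \<ge> 0 \<Longrightarrow> B n vac = 0"
  shows "k \<ge> 0 \<Longrightarrow> nth_product A n B k vac = 0"
    and "nth_product A n B (- 1) vac = A n (B (- 1) vac)"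
proof -
  have r: "ordered_product B A vac n k 0 = 0" for k
    by (rule ordered_product_vanishes [of _ 0]) (use assms in auto)
  show "nth_product A n B k vac = 0" if "k \<ge> 0"
    using ordered_product_vanishes [of A 0 B vac k n 0] that assms r
    by (simp add: nth_product_def residue_product_def)
  have "ordered_product A B vac n 0 (- 1) = A n (B (- 1) vac)"
    unfolding ordered_product_def by (subst Sum_any_only_0) (simp_all add: assms End_simps)
  then show "nth_product A n B (- 1) vac = A n (B (- 1) vac)"
    by (simp add: nth_product_def residue_product_def r)
qed

section \<open>Locality and Dong's lemma\<close>

text \<open>
  The condition \<open>(z - w)\<^sup>N [A(z), B(w)] = 0\<close>.  The exponent must not depend on \<open>v\<close>.
\<close>
definition mutually_local :: "'v formal_series \<Rightarrow> 'v formal_series \<Rightarrow> bool"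
  where "mutually_local A B \<longleftrightarrow>
    (\<exists>N. \<forall>v. (delta ^^ N) (\<lambda>i k. commutator (A i) (B k) v) = (\<lambda>i k. 0))"

lemma mutually_local_sym: "mutually_local A B \<Longrightarrow> mutually_local B A"
  unfolding mutually_local_def
proof (elim exE)
  fix N assume N: "\<forall>v. (delta ^^ N) (\<lambda>i k. commutator (A i) (B k) v) = (\<lambda>i k. 0)"
  have "(delta ^^ N) (\<lambda>i k. commutator (B i) (A k) v) = (\<lambda>i k. 0)" for v
  proof -
    have "(\<lambda>i k. commutator (B i) (A k) v) = (\<lambda>i k. - commutator (A k) (B i) v)"
      by (auto simp: commutator_def)
    moreover have "(delta ^^ N) (\<lambda>i k. - commutator (A k) (B i) v) = (\<lambda>i k. 0)"
      using delta_pow_map [of "\<lambda>_. uminus" N "\<lambda>i k. commutator (A k) (B i) v"]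
        delta_pow_swap [OF spec [OF N, of v]]
      by simp
    ultimately show ?thesis by simp
  qed
  then show "\<exists>N. \<forall>v. (delta ^^ N) (\<lambda>i k. commutator (B i) (A k) v) = (\<lambda>i k. 0)" by blast
qed

text \<open>
  For \<open>n \<ge> 0\<close> both expansions of \<open>(z - w)\<^sup>n\<close> agree, so the residue product is the \<open>n\<close>-th difference of
  the commutator.
\<close>
lemma residue_product_local:
  assumes "A \<in> End_series scale" "truncated A" "B \<in> End_series scale" "truncated B"
    and "mutually_local A B"
  shows "\<exists>N. \<forall>n\<ge>N. \<forall>v i k. residue_product A B v n i k = 0"
proof -
  obtain N where N: "\<And>v. (delta ^^ N) (\<lambda>i k. commutator (A i) (B k) v) = (\<lambda>i k. 0)"
    using assms(5) by (auto simp: mutually_local_def)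
  have pow: "residue_product A B v (int n) = (delta ^^ n) (\<lambda>i k. commutator (A i) (B k) v)" for v n
  proof (induction n)
    case 0
    show ?case by (auto simp: residue_product_0)
  next
    case (Suc n)
    then show ?case using residue_product_Suc [OF assms(1-4), of v "int n"] by (simp add: add.commute)
  qed
  have "residue_product A B v n i k = 0" if "n \<ge> int N" for n v i k
  proof -
    have "nat n \<ge> N" "int (nat n) = n" using that by auto
    then show ?thesis using delta_pow_mono [OF N] pow [of v "nat n"] by simp
  qed
  then show ?thesis by blast
qed

text \<open>
  By Leibniz, \<open>[C(u), A(z) B(w)] = [C(u), A(z)] B(w) + A(z) [C(u), B(w)]\<close>, and the two terms are killed
  by \<open>(u - z)\<^sup>a\<close> and \<open>(u - w)\<^sup>b\<close>.  The factor \<open>(z - w)\<^sup>n\<close> does no harm, by the recursion in \<open>n\<close>.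
\<close>
lemma ordered_product_commutator_zero:
  assumes A: "A \<in> End_series scale" and B: "truncated B" and C: "C \<in> End_series scale"
    and CA: "\<And>v. (delta ^^ a) (\<lambda>m i. commutator (C m) (A i) v) = (\<lambda>m i. 0)"
    and CB: "\<And>v. (delta ^^ b) (\<lambda>m k. commutator (C m) (B k) v) = (\<lambda>m k. 0)"
  shows "(delta_uz ^^ a) ((delta_uw ^^ b)
    (\<lambda>m i k. C m (ordered_product A B v n i k) - ordered_product A B (C m v) n i k)) = zero3"
    (is "(delta_uz ^^ a) ((delta_uw ^^ b) (?F n)) = zero3")
proof (rule delta3_family_zero)
  show "?F (n + 1) = delta_zw (?F n)" for n
    by (intro ext) (simp add: delta_zw_def delta_def ordered_product_Suc [OF A B] End_simps C)
  show "\<exists>K. \<forall>i k. k \<ge> K \<longrightarrow> ?F n m i k = 0" for n m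
  proof -
    obtain K K' where "\<forall>i k. k \<ge> K \<longrightarrow> ordered_product A B v n i k = 0"
      "\<forall>i k. k \<ge> K' \<longrightarrow> ordered_product A B (C m v) n i k = 0"
      using ordered_product_bound [OF A B] by metis
    then show ?thesis by (intro exI [of _ "max K K'"]) (simp add: End_simps C)
  qed
  let ?f = "\<lambda>m i k. commutator (C m) (A i) (B k v)"
  let ?g = "\<lambda>m i k. A i (commutator (C m) (B k) v)"
  have F0: "?F 0 = (\<lambda>m i k. ?f m i k + ?g m i k)"
    by (intro ext) (simp add: ordered_product_0 commutator_def End_simps A)
  have f: "(delta_uz ^^ a) ?f = zero3"
    by (intro ext) (simp add: delta_uz_pow CA)
  have g: "(delta_uw ^^ b) ?g = zero3"
  proof (intro ext)
    fix m i k
    have "(delta ^^ b) (\<lambda>m k. A i (commutator (C m) (B k) v)) m k = A i 0"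
      using delta_pow_map [of "\<lambda>_. A i" b "\<lambda>m k. commutator (C m) (B k) v"] CB
      by (simp add: End_simps A)
    then show "(delta_uw ^^ b) ?g m i k = 0" by (simp add: delta_uw_pow End_simps A)
  qed
  show "(delta_uz ^^ a) ((delta_uw ^^ b) (?F 0)) = zero3"
    unfolding F0 delta3_add g using f by (simp add: delta3_commute)
qed

text \<open>
  Dong's lemma.  Write \<open>F n\<close> for the coefficients of \<open>(z - w)\<^sup>n [C(u), [A(z), B(w)]]\<close>, with the expansions of
  the residue product.  It is killed by \<open>(u - z)\<^sup>a (u - w)\<^sup>b\<close>, and by \<open>(z - w)\<^sup>c\<close> for large \<open>c\<close>, because
  this factor turns it into \<open>F (n + c)\<close>.  Hence \<open>(u - w)\<^sup>a\<^sup>+\<^sup>c\<^sup>+\<^sup>b\<close> kills it.  This last operator leaves \<open>i\<close>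
  alone, and at \<open>i = 0\<close> the function is \<open>[C\<^sub>m, (A\<^bsub>(n)\<^esub>B)\<^sub>k]\<close>.
\<close>
lemma dong:
  assumes A: "A \<in> End_series scale" "truncated A" and B: "B \<in> End_series scale" "truncated B"
    and C: "C \<in> End_series scale"
    and AB: "mutually_local A B" and CA: "mutually_local C A" and CB: "mutually_local C B"
  shows "mutually_local C (nth_product A n B)"
proof -
  obtain a where a: "\<And>v. (delta ^^ a) (\<lambda>m i. commutator (C m) (A i) v) = (\<lambda>m i. 0)"
    using CA by (auto simp: mutually_local_def)
  obtain b where b: "\<And>v. (delta ^^ b) (\<lambda>m i. commutator (C m) (B i) v) = (\<lambda>m i. 0)"
    using CB by (auto simp: mutually_local_def)
  obtain N where N: "\<And>n v i k. n \<ge> N \<Longrightarrow> residue_product A B v n i k = 0"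
    using residue_product_local [OF A B AB] by blast
  define c where "c = nat (N - n)"
  have "(delta ^^ (a + c + b)) (\<lambda>m k. commutator (C m) (nth_product A n B k) v) = (\<lambda>m k. 0)" for v
  proof -
    define F where "F n m i k = C m (residue_product A B v n i k) - residue_product A B (C m v) n i k"
      for n m i k
    \<comment> \<open>The sign in front of the second ordered product is moved into the vector it acts on, so
        that both summands have the form treated by \<open>ordered_product_commutator_zero\<close>.\<close>
    define s where "s = - ((-1) powi n :: complex)"
    define P where "P m i k = C m (ordered_product A B v n i k) - ordered_product A B (C m v) n i k"
      for m i k
    define Q where "Q m i k = C m (ordered_product B A (scale s v) n i k)
      - ordered_product B A (C m (scale s v)) n i k" for m i k
    have "(delta_uz ^^ a) ((delta_uw ^^ b) P) = zero3"
      unfolding P_def by (rule ordered_product_commutator_zero [OF A(1) B(2) C a b])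
    moreover have "(delta_uz ^^ a) ((delta_uw ^^ b) (\<lambda>m i k. Q m k i)) = zero3"
    proof -
      have "(delta_uz ^^ b) ((delta_uw ^^ a) Q) = zero3"
        unfolding Q_def by (rule ordered_product_commutator_zero [OF B(1) A(2) C b a])
      then show ?thesis
        by (simp add: delta_uw_pow_swap [of b Q] delta_uz_pow_swap [of a "(delta_uz ^^ b) Q"]
            flip: delta3_commute(1))
    qed
    moreover have "F n = (\<lambda>m i k. P m i k + Q m k i)"
    proof (intro ext)
      fix m i k
      have "residue_product A B v n i k =
          ordered_product A B v n i k + scale s (ordered_product B A v n k i)" for v
        by (simp add: residue_product_def s_def)
      then show "F n m i k = P m i k + Q m k i"
        by (simp add: F_def P_def Q_def A B C ordered_product_scale End_simps)
    qed
    ultimately have uz: "(delta_uz ^^ a) ((delta_uw ^^ b) (F n)) = zero3"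
      by (simp only: delta3_add) simp
    have "(delta_zw ^^ j) (F n) = F (n + int j)" for j
    proof (induction j)
      case (Suc j)
      have "F (n + int j + 1) = delta_zw (F (n + int j))"
        by (intro ext) (simp add: F_def residue_product_Suc A B delta_zw_def delta_def End_simps C)
      then show ?case using Suc by (simp add: algebra_simps)
    qed simp
    moreover have "F (n + int c) = zero3"
      by (intro ext) (simp add: F_def N c_def End_simps C)
    ultimately have zw: "(delta_zw ^^ c) ((delta_uw ^^ b) (F n)) = zero3"
      by (simp flip: delta3_commute(3))
    have "(delta_uw ^^ (a + c + b)) (F n) = zero3"
      using delta_uw_pow_zero [OF uz zw] by (simp add: funpow_add)
    then have "(delta ^^ (a + c + b)) (\<lambda>m k. F n m 0 k) m k = 0" for m k
      unfolding delta_uw_pow [of _ "F n" m 0 k, symmetric] by simp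
    moreover have "(\<lambda>m k. F n m 0 k) = (\<lambda>m k. commutator (C m) (nth_product A n B k) v)"
      by (intro ext) (simp add: F_def commutator_def nth_product_def)
    ultimately show ?thesis by (simp add: fun_eq_iff)
  qed
  then show ?thesis unfolding mutually_local_def by blast
qed

lemma mutually_local_add:
  assumes C: "C \<in> End_series scale" and "mutually_local A C" and "mutually_local B C"
  shows "mutually_local (\<lambda>n v. A n v + B n v) C"
proof -
  obtain M N where M: "\<And>v. (delta ^^ M) (\<lambda>i k. commutator (A i) (C k) v) = (\<lambda>i k. 0)"
    and N: "\<And>v. (delta ^^ N) (\<lambda>i k. commutator (B i) (C k) v) = (\<lambda>i k. 0)"
    using assms(2,3) by (auto simp: mutually_local_def)
  have "(delta ^^ (max M N)) (\<lambda>i k. commutator (A i) (C k) v) = (\<lambda>i k. 0)"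
    "(delta ^^ (max M N)) (\<lambda>i k. commutator (B i) (C k) v) = (\<lambda>i k. 0)" for v
    using delta_pow_mono [OF M] delta_pow_mono [OF N] by simp_all
  moreover have "(\<lambda>i k. commutator (\<lambda>v. A i v + B i v) (C k) v) =
      (\<lambda>i k. commutator (A i) (C k) v + commutator (B i) (C k) v)" for v
    by (simp add: commutator_def End_simps C algebra_simps)
  ultimately have "(delta ^^ (max M N)) (\<lambda>i k. commutator (\<lambda>v. A i v + B i v) (C k) v) = (\<lambda>i k. 0)" for v
    by (simp add: delta_pow_add)
  then show ?thesis unfolding mutually_local_def by blast
qed

lemma mutually_local_scale:
  assumes C: "C \<in> End_series scale" and "mutually_local A C"
  shows "mutually_local (\<lambda>n v. scale a (A n v)) C"
proof -
  obtain N where N: "\<And>v. (delta ^^ N) (\<lambda>i k. commutator (A i) (C k) v) = (\<lambda>i k. 0)"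
    using assms(2) by (auto simp: mutually_local_def)
  have "(delta ^^ N) (\<lambda>i k. commutator (\<lambda>v. scale a (A i v)) (C k) v) = (\<lambda>i k. 0)" for v
    using delta_pow_map [of "\<lambda>_. scale a" N "\<lambda>i k. commutator (A i) (C k) v"]
    by (simp add: commutator_def [of "\<lambda>v. scale a (A _ v)"] commutator_def [of "A _"] N
        End_simps C scale_right_diff_distrib)
      (simp add: N flip: commutator_def)
  then show ?thesis unfolding mutually_local_def by blast
qed

text \<open>
  Along an antidiagonal, \<open>m \<mapsto> m gchoose l\<close> is a polynomial of degree \<open>l\<close>, and \<^const>\<open>delta\<close> is the
  forward difference in \<open>m\<close>.
\<close>
lemma delta_pow_gbinomial:
  "(delta ^^ Suc l) (\<lambda>m k. scale (of_int m gchoose l) (g (m + k))) = (\<lambda>m k. 0)"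
proof (induction l arbitrary: g)
  case 0
  show ?case by (auto simp: delta_def algebra_simps)
next
  case (Suc l)
  have "delta (\<lambda>m k. scale (of_int m gchoose Suc l) (g (m + k))) =
      (\<lambda>m k. scale (of_int m gchoose l) (g (m + k + 1)))"
  proof (intro ext)
    fix m k :: int
    have "m + 1 + k = m + k + 1 \<and> m + (k + 1) = m + k + 1" by simp
    moreover have "(complex_of_int (m + 1) gchoose Suc l) = (of_int m gchoose l) + (of_int m gchoose Suc l)"
      by (simp add: gbinomial_Suc_Suc)
    ultimately show "delta (\<lambda>m k. scale (of_int m gchoose Suc l) (g (m + k))) m k =
        scale (of_int m gchoose l) (g (m + k + 1))"
      by (simp only: delta_def scale_left_distrib) simp
  qed
  then show ?case using Suc [of "\<lambda>s. g (s + 1)"]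
    by (simp only: funpow_Suc_right o_apply)
qed

lemma mutually_local_if_local_fields:
  assumes "local_fields scale A B"
  shows "mutually_local A B"
proof -
  obtain M C where C: "\<And>m k v. commutator (A m) (B k) v =
      (\<Sum>l<M::nat. scale (of_int m gchoose l) (C l (m + k - int l) v))"
    using assms unfolding local_fields_def by blast
  have "(delta ^^ N) (\<lambda>m k. \<Sum>l<N. scale (of_int m gchoose l) (C l (m + k - int l) v)) = (\<lambda>m k. 0)"
    for N v
  proof (induction N)
    case (Suc N)
    have "(delta ^^ Suc N) (\<lambda>m k. \<Sum>l<N. scale (of_int m gchoose l) (C l (m + k - int l) v)) = (\<lambda>m k. 0)"
      using Suc by (rule delta_pow_mono) simp
    then show ?case
      using delta_pow_gbinomial [of N "\<lambda>s. C N (s - int N) v"]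
      by (simp only: sum.lessThan_Suc delta_pow_add) simp
  qed simp
  then show ?thesis unfolding mutually_local_def C by blast
qed

section \<open>The Jacobi identity\<close>

lemma Sum_any_scale:
  assumes "c \<noteq> 0"
  shows "Sum_any (\<lambda>l. scale c (g l)) = scale c (Sum_any g)"
proof (cases "finite {l. g l \<noteq> 0}")
  case True
  have "endo scale (scale c)" by (simp add: endo_iff scale_right_distrib)
  from endo_Sum_any [OF this True] show ?thesis by simp
qed (use assms in simp)

lemma residue_product_eq_Sum_any:
  "Sum_any (\<lambda>l::nat. scale ((-1) ^ l * (of_int n gchoose l)) (A (m + n - int l) (B (k + int l) w))) -
   Sum_any (\<lambda>l::nat. scale ((-1) powi (n + int l) * (of_int n gchoose l))
     (B (n + k - int l) (A (m + int l) w))) = residue_product A B w n m k"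
proof -
  have "(\<lambda>l::nat. scale ((-1) powi (n + int l) * (of_int n gchoose l)) (B (n + k - int l) (A (m + int l) w))) =
      (\<lambda>l. scale ((-1) powi n) (scale ((-1) ^ l * (of_int n gchoose l)) (B (k + n - int l) (A (m + int l) w))))"
    by (simp add: power_int_add mult.assoc add.commute)
  then show ?thesis
    by (simp only: residue_product_def ordered_product_def
        Sum_any_scale [OF power_int_not_zero [of "-1 :: complex" n]] simp_thms neg_equal_0_iff_equal
        one_neq_zero not_False_eq_True)
qed

text \<open>At \<open>m = 0\<close> only the term \<open>l = 0\<close> survives on the left of the Jacobi identity.\<close>
lemma iterate_if_jacobi:
  assumes "jacobi_identity scale Y"
  shows "Y (Y u n v) k w = nth_product (Y u) n (Y v) k w"
proof -
  have "Sum_any (\<lambda>l::nat. scale (of_int 0 gchoose l) (Y (Y u (n + int l) v) (0 + k - int l) w)) =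
      residue_product (Y u) (Y v) w n 0 k"
    using assms unfolding jacobi_identity_def Let_def
    by (simp only: residue_product_eq_Sum_any)
  moreover have "Sum_any (\<lambda>l::nat. scale (of_int 0 gchoose l) (Y (Y u (n + int l) v) (0 + k - int l) w)) =
      Y (Y u n v) k w"
    by (subst Sum_any_only_0) simp_all
  ultimately show ?thesis by (simp only: nth_product_def)
qed

text \<open>
  Both sides of the Jacobi identity, and hence their difference \<open>X\<close>, satisfy
  \<open>X (m + 1) n k = X m n (k + 1) + X m (n + 1) k\<close>, which reflects \<open>z = w + (z - w)\<close>.  The difference
  vanishes at \<open>m = 0\<close> by the iterate formula, and for all large \<open>n\<close> by truncation and locality.
  Going up in \<open>m\<close> is immediate.  Going down, \<open>X (m - 1) n k = - X (m - 1) (n + 1) (k - 1)\<close>, and \<open>n\<close> can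
  be pushed into the region where \<open>X\<close> vanishes.
\<close>
lemma jacobi_if_iterate_and_local:
  assumes Y: "\<And>u. Y u \<in> End_series scale" "\<And>u. truncated (Y u)"
    and Y0: "\<And>n w. Y 0 n w = 0"
    and iterate: "\<And>u n v. Y (Y u n v) = nth_product (Y u) n (Y v)"
    and loc: "\<And>u v. mutually_local (Y u) (Y v)"
  shows "jacobi_identity scale Y"
proof -
  have fin: "finite {l::nat. scale (c l) (Y (Y u (n + int l) v) (d l) w) \<noteq> 0}" for c d u v w n
  proof -
    obtain N where "\<And>n. n \<ge> N \<Longrightarrow> Y u n v = 0" using truncatedD [OF Y(2)] by metis
    then show ?thesis
      by (rule finite_int_shift [where f = "\<lambda>n. Y u n v" and k = n]) (auto simp: Y0)
  qed
  have main: "Sum_any (\<lambda>l::nat. scale (of_int m gchoose l) (Y (Y u (n + int l) v) (m + k - int l) w)) =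
      residue_product (Y u) (Y v) w n m k" for u v w m n k
  proof -
    define P where "P m n k =
      Sum_any (\<lambda>l::nat. scale (of_int m gchoose l) (Y (Y u (n + int l) v) (m + k - int l) w))" for m n k
    define X where "X m n k = P m n k - residue_product (Y u) (Y v) w n m k" for m n k
    have P: "P (m + 1) n k = P m n (k + 1) + P m (n + 1) k" for m n k
      unfolding P_def
    proof (rule Sum_any_shift)
      fix l
      have ix: "m + 1 + k - int (Suc l) = m + k - int l" "m + (k + 1) - int (Suc l) = m + k - int l"
        "n + 1 + int l = n + int (Suc l)" by simp_all
      have c: "(complex_of_int (m + 1) gchoose Suc l) = (of_int m gchoose Suc l) + (of_int m gchoose l)"
        by (simp add: gbinomial_Suc_Suc)
      show "scale (of_int (m + 1) gchoose Suc l) (Y (Y u (n + int (Suc l)) v) (m + 1 + k - int (Suc l)) w) =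
        scale (of_int m gchoose Suc l) (Y (Y u (n + int (Suc l)) v) (m + (k + 1) - int (Suc l)) w) +
        scale (of_int m gchoose l) (Y (Y u (n + 1 + int l) v) (m + k - int l) w)"
        unfolding ix c by (rule scale_left_distrib)
    qed ((rule fin)+, simp add: algebra_simps)
    have X: "X (m + 1) n k = X m n (k + 1) + X m (n + 1) k" for m n k
      by (simp only: X_def P residue_product_Suc Y) (simp add: delta_def)
    have X0: "X 0 n k = 0" for n k
    proof -
      have "P 0 n k = Y (Y u n v) k w"
        unfolding P_def by (subst Sum_any_only_0) simp_all
      then show ?thesis by (simp add: X_def iterate nth_product_def)
    qed
    obtain N where N: "\<And>m n k. n \<ge> N \<Longrightarrow> X m n k = 0"
    proof -
      obtain N1 where "\<And>n. n \<ge> N1 \<Longrightarrow> Y u n v = 0" using truncatedD [OF Y(2)] by metis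
      moreover obtain N2 where "\<And>n i k. n \<ge> N2 \<Longrightarrow> residue_product (Y u) (Y v) w n i k = 0"
        using residue_product_local [OF Y(1,2) Y(1,2) loc] by metis
      ultimately have "X m n k = 0" if "n \<ge> max N1 N2" for m n k
        using that by (simp add: X_def P_def Y0)
      then show ?thesis using that by blast
    qed
    have "\<forall>n k. X m n k = 0"
    proof (induction m rule: int_induct [where k = 0])
      case (step1 m)
      then show ?case by (simp add: X)
    next
      case (step2 m)
      have step: "X (m - 1) n k = - X (m - 1) (n + 1) (k - 1)" for n k
        using X [of "m - 1" n "k - 1"] step2 by (simp add: eq_neg_iff_add_eq_0)
      have "X (m - 1) n k = 0" if "n \<ge> N - int j" for j n k
        using that
      proof (induction j arbitrary: n k)
        case (Suc j)
        have "X (m - 1) (n + 1) (k - 1) = 0" by (rule Suc.IH) (use Suc.prems in simp)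
        then show ?case unfolding step [of n k] by simp
      qed (simp add: N)
      from this [of "nat (N - n)" n for n] show ?case by simp
    qed (simp add: X0)
    then show ?thesis by (simp add: X_def P_def)
  qed
  show ?thesis
    unfolding jacobi_identity_def Let_def residue_product_eq_Sum_any main
  proof (intro allI conjI refl)
    fix u v w m n k
    show "finite {l::nat. scale (of_int m gchoose l) (Y (Y u (n + int l) v) (m + k - int l) w) \<noteq> 0}"
      by (rule fin)
    show "finite {l::nat. scale ((-1) ^ l * (of_int n gchoose l))
        (Y u (m + n - int l) (Y v (k + int l) w)) \<noteq> 0}"
      by (rule ordered_product_finite) (rule Y)+
    show "finite {l::nat. scale ((-1) powi (n + int l) * (of_int n gchoose l))
        (Y v (n + k - int l) (Y u (m + int l) w)) \<noteq> 0}"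
      by (rule ordered_product_finite) (rule Y)+
  qed
qed

section \<open>Homogeneous fields are truncated\<close>
lemma homogeneous_fieldD:
  assumes "homogeneous_field scale L0 A"
  obtains d :: int where
    "\<And>n v. L0 (A n v) = A n (L0 v) + scale (of_int (d - n - 1)) (A n v)"
proof -
  obtain d :: int where "\<And>n v. L0 (A n v) - A n (L0 v) =
      scale (of_int d) (A n v) + scale (- of_int (n + 1)) (A n v)"
    using assms by (auto simp: homogeneous_field_def commutator_def times_z_def dz_def)
  then have "\<And>n v. L0 (A n v) = A n (L0 v) + scale (of_int (d - n - 1)) (A n v)"
    by (simp add: diff_eq_eq scale_left_diff_distrib scale_left_distrib algebra_simps)
  then show ?thesis using that by blast
qed

text \<open>
  On an eigenvector of degree \<open>a\<close>, the mode \<open>A\<^sub>n\<close> has image of degree \<open>a + d - n - 1\<close>, which is negative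
  for large \<open>n\<close>, whereas all degrees are natural numbers; eigenvectors span.
\<close>
lemma homogeneous_truncated:
  assumes L0: "grading_operator scale L0" and hom: "homogeneous_field scale L0 A"
  shows "truncated A"
  unfolding truncated_def
proof
  fix v
  have A: "A \<in> End_series scale" using hom by (simp add: homogeneous_field_def)
  obtain d :: int where d: "\<And>n v. L0 (A n v) = A n (L0 v) + scale (of_int (d - n - 1)) (A n v)"
    using homogeneous_fieldD [OF hom] by blast
  obtain B where B: "span B = UNIV" "\<And>b. b \<in> B \<Longrightarrow> \<exists>a. L0 b = scale a b"
    using L0 by (auto simp: grading_operator_def diagonalizable_def)
  have "v \<in> span B" by (simp add: B)
  then show "\<exists>N. \<forall>n\<ge>N. A n v = 0"
  proof (rule span_induct)
    show "subspace {v. \<exists>N. \<forall>n\<ge>N. A n v = 0}"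
    proof (rule subspaceI)
      fix x y assume "x \<in> {v. \<exists>N. \<forall>n\<ge>N. A n v = 0}" "y \<in> {v. \<exists>N. \<forall>n\<ge>N. A n v = 0}"
      then obtain M N where "\<forall>n\<ge>M. A n x = 0" "\<forall>n\<ge>N. A n y = 0" by auto
      then have "\<forall>n\<ge>max M N. A n (x + y) = 0" by (simp add: End_simps A)
      then show "x + y \<in> {v. \<exists>N. \<forall>n\<ge>N. A n v = 0}" by blast
    qed (auto simp: End_simps A)
    fix b assume "b \<in> B"
    then obtain a where a: "L0 b = scale a b" using B by blast
    have "A n b = 0" if "n \<ge> \<lceil>Re a\<rceil> + d" for n
    proof (rule ccontr)
      assume nz: "A n b \<noteq> 0"
      have "L0 (A n b) = scale (a + of_int (d - n - 1)) (A n b)"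
        by (simp only: d a End_simps A scale_left_distrib)
      then have "a + of_int (d - n - 1) \<in> \<nat>"
        using L0 nz by (auto simp: grading_operator_def)
      then have "Re (a + of_int (d - n - 1)) \<ge> 0"
        by (metis Nats_cases complex_Re_of_nat of_nat_0_le_iff)
      then have "Re a + of_int (d - n - 1) \<ge> 0" by simp
      moreover have "\<lceil>Re a\<rceil> \<le> n - d" using that by simp
      then have "Re a \<le> of_int (n - d)" by (simp only: ceiling_le_iff)
      ultimately show False by simp
    qed
    then show "\<exists>N. \<forall>n\<ge>N. A n b = 0" by blast
  qed
qed

end

section \<open>The state-field correspondence\<close>

locale generating_fields = complex_vector_space scale
  for scale :: "complex \<Rightarrow> 'v::ab_group_add \<Rightarrow> 'v" +
  fixes L0 T :: "'v \<Rightarrow> 'v"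
    and vac :: 'v
    and E :: "'v formal_series set"
  assumes L0: "grading_operator scale L0"
    and hom: "\<And>A. A \<in> E \<Longrightarrow> homogeneous_field scale L0 A"
    and vac: "vac \<in> homogeneous_component scale L0 0"
    and E_vac: "\<And>A n. A \<in> E \<Longrightarrow> n \<ge> 0 \<Longrightarrow> A n vac = 0"
    and T: "endo scale T"
    and T_vac: "T vac = 0"
    and E_T: "\<And>A n v. A \<in> E \<Longrightarrow> commutator T (A n) v = dz scale A n v"
    and generating: "span (mode_monomials E vac) = UNIV"
    and E_local: "\<And>A B. A \<in> E \<Longrightarrow> B \<in> E \<Longrightarrow> local_fields scale A B"
begin

lemma L0_endo: "endo scale L0"
  using L0 by (simp add: grading_operator_def)

lemma L0_vac: "L0 vac = 0"
  using vac by (simp add: homogeneous_component_def)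

lemma E_End: "A \<in> E \<Longrightarrow> A \<in> End_series scale"
  using hom by (simp add: homogeneous_field_def)

lemma generating_induct [consumes 0, case_names subspace vac step]:
  assumes sub: "subspace {v. P v}"
    and vac: "P vac"
    and step: "\<And>A n v. A \<in> E \<Longrightarrow> P v \<Longrightarrow> P (A n v)"
  shows "P v"
proof -
  have "v \<in> span (mode_monomials E vac)" by (simp add: generating)
  then show ?thesis
  proof (rule span_induct)
    fix x assume "x \<in> mode_monomials E vac"
    then obtain ps where ps: "x = foldr (\<lambda>(A, n) v. A n v) ps vac" "fst ` set ps \<subseteq> E"
      by (auto simp: mode_monomials_def)
    have "P (foldr (\<lambda>(A, n) v. A n v) ps vac)"
      using ps(2) by (induction ps) (auto intro: vac step)
    then show "P x" by (simp add: ps)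
  qed (rule sub)
qed

text \<open>
  Locality is required against \<open>E\<close> only; that vertex fields are local to each other is a consequence
  (\<open>Y_local\<close>).
\<close>
definition vertex_field :: "'v formal_series \<Rightarrow> bool"
  where "vertex_field A \<longleftrightarrow> A \<in> End_series scale \<and> truncated A \<and> (\<forall>n\<ge>0. A n vac = 0) \<and>
    covariant T A \<and> (\<forall>B\<in>E. mutually_local A B)"

lemma vertex_field_E: "A \<in> E \<Longrightarrow> vertex_field A"
  using E_End E_vac E_T homogeneous_truncated [OF L0 hom] mutually_local_if_local_fields [OF E_local]
  by (simp add: vertex_field_def covariant_def)

lemma E_truncated: "A \<in> E \<Longrightarrow> truncated A"
  using vertex_field_E by (simp add: vertex_field_def)

lemma vertex_field_local:
  assumes "vertex_field A" "B \<in> E"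
  shows "mutually_local A B" "mutually_local B A"
  using assms mutually_local_sym by (auto simp: vertex_field_def)

text \<open>
  Goddard's uniqueness.  On the vacuum, covariance computes \<open>A\<^bsub>-2-j\<^esub>\<^bold>1\<close> from \<open>A\<^bsub>-1-j\<^esub>\<^bold>1\<close>.  If all
  \<open>A\<^sub>i\<close> kill \<open>w\<close> and \<open>B \<in> E\<close>, then \<open>[A\<^sub>i, B\<^sub>k]w = A\<^sub>i B\<^sub>k w\<close> vanishes for large \<open>k\<close>, and a power of
  \<open>z - w\<close> kills it; so it is zero.
\<close>
lemma vertex_field_eq_zero:
  assumes A: "vertex_field A" and state: "A (- 1) vac = 0"
  shows "A n v = 0"
proof -
  have End: "A \<in> End_series scale" and cov: "covariant T A" using A by (auto simp: vertex_field_def)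
  have "\<forall>n. A n v = 0"
  proof (induction v rule: generating_induct)
    case subspace
    show ?case by (rule subspaceI) (auto simp: End_simps End)
  next
    case vac
    have neg: "A (- 1 - int j) vac = 0" for j
    proof (induction j)
      case (Suc j)
      have "T (A (- 1 - int j) vac) =
          A (- 1 - int j) (T vac) - scale (of_int (- 1 - int j)) (A (- 1 - int j - 1) vac)"
        by (rule covariantD [OF cov])
      then have "scale (of_int (- 1 - int j)) (A (- 1 - int j - 1) vac) = 0"
        unfolding Suc T_vac endo_zero [OF T] endo_zero [OF EndD [OF End]] by (metis diff_0 neg_equal_0_iff_equal)
      moreover have "- 1 - int j - 1 = - 1 - int (Suc j)" by simp
      moreover have "complex_of_int (- 1 - int j) \<noteq> 0"
        unfolding of_int_eq_0_iff by simp
      ultimately show ?case unfolding scale_eq_0_iff by metis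
    qed (simp add: state)
    show ?case
    proof
      fix n show "A n vac = 0"
        using A neg [of "nat (- 1 - n)"] by (cases "n \<ge> 0") (auto simp: vertex_field_def)
    qed
  next
    case (step B j w)
    obtain N where N: "(delta ^^ N) (\<lambda>i k. commutator (A i) (B k) w) = (\<lambda>i k. 0)"
      using vertex_field_local(1) [OF A step(1)] unfolding mutually_local_def by blast
    obtain K where K: "\<And>k. k \<ge> K \<Longrightarrow> B k w = 0"
      using truncatedD [OF E_truncated [OF step(1)]] by metis
    have "(\<lambda>i k. commutator (A i) (B k) w) = (\<lambda>i k. 0)"
      using N by (rule zero_if_delta_pow_zero [of N _ K])
        (use K step(2) in \<open>simp add: commutator_def End_simps End E_End [OF step(1)]\<close>)
    then have "commutator (A i) (B j) w = 0" for i by meson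
    then show ?case using step(2) by (simp add: commutator_def End_simps E_End [OF step(1)])
  qed
  then show ?thesis by blast
qed

lemma vertex_field_add:
  assumes "vertex_field A" "vertex_field B"
  shows "vertex_field (\<lambda>n v. A n v + B n v)"
  unfolding vertex_field_def
proof (intro conjI ballI allI impI)
  have End: "A \<in> End_series scale" "B \<in> End_series scale" using assms by (auto simp: vertex_field_def)
  then show "(\<lambda>n v. A n v + B n v) \<in> End_series scale"
    unfolding End_series_def by (auto simp: endo_iff scale_right_distrib)
  show "truncated (\<lambda>n v. A n v + B n v)"
    unfolding truncated_def
  proof
    fix v
    obtain M N where "\<forall>n\<ge>M. A n v = 0" "\<forall>n\<ge>N. B n v = 0"
      using assms by (meson truncatedD vertex_field_def)
    then show "\<exists>N. \<forall>n\<ge>N. A n v + B n v = 0" by (intro exI [of _ "max M N"]) simp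
  qed
  show "covariant T (\<lambda>n v. A n v + B n v)"
    using assms by (simp add: vertex_field_def covariant_def commutator_def dz_def endo_add [OF T]
        scale_right_distrib algebra_simps)
qed (use assms in \<open>auto simp: vertex_field_def intro: mutually_local_add E_End\<close>)

lemma vertex_field_scale:
  assumes "vertex_field A"
  shows "vertex_field (\<lambda>n v. scale a (A n v))"
  unfolding vertex_field_def
proof (intro conjI ballI allI impI)
  have End: "A \<in> End_series scale" using assms by (auto simp: vertex_field_def)
  then show "(\<lambda>n v. scale a (A n v)) \<in> End_series scale"
    unfolding End_series_def by (auto simp: endo_iff scale_right_distrib mult.commute)
  show "truncated (\<lambda>n v. scale a (A n v))"
    using assms unfolding vertex_field_def truncated_def by (metis scale_zero_right)
  show "covariant T (\<lambda>n v. scale a (A n v))"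
    unfolding covariant_def
  proof (intro allI)
    fix n v
    have "T (A n v) = A n (T v) - scale (of_int n) (A (n - 1) v)"
      using assms by (simp add: vertex_field_def covariantD)
    then show "commutator T (\<lambda>v. scale a (A n v)) v = dz scale (\<lambda>n v. scale a (A n v)) n v"
      by (simp add: commutator_def dz_def endo_scale [OF T] scale_right_diff_distrib mult.commute)
  qed
qed (use assms in \<open>auto simp: vertex_field_def intro: mutually_local_scale E_End\<close>)

lemma vertex_field_vac: "vertex_field (\<lambda>n w. if n = - 1 then w else 0)"
proof -
  let ?I = "\<lambda>n w. if n = - 1 then w else (0::'v)"
  have "?I \<in> End_series scale" by (auto simp: End_series_def endo_iff)
  moreover have "truncated ?I" unfolding truncated_def by (intro allI exI [of _ 0]) simp
  moreover have "covariant T ?I"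
    by (auto simp: covariant_def commutator_def dz_def endo_zero [OF T])
  moreover have "mutually_local ?I B" if "B \<in> E" for B
    unfolding mutually_local_def
    by (rule exI [of _ 0]) (auto simp: commutator_def fun_eq_iff EndD [OF E_End [OF that], THEN endo_zero])
  ultimately show ?thesis by (auto simp: vertex_field_def)
qed

lemma vertex_field_nth_product:
  assumes A: "vertex_field A" and B: "vertex_field B" and AB: "mutually_local A B"
  shows "vertex_field (nth_product A n B)"
proof -
  have A': "A \<in> End_series scale" "truncated A" "covariant T A" "\<And>n. n \<ge> 0 \<Longrightarrow> A n vac = 0"
    and B': "B \<in> End_series scale" "truncated B" "covariant T B" "\<And>n. n \<ge> 0 \<Longrightarrow> B n vac = 0"
    using A B by (auto simp: vertex_field_def)
  have "mutually_local (nth_product A n B) C" if C: "C \<in> E" for C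
    by (intro mutually_local_sym [OF dong] A' B' AB E_End vertex_field_local(2) A B C)
  then show ?thesis
    using A' B' T
    by (simp add: vertex_field_def nth_product_End nth_product_truncated nth_product_covariant
        nth_product_vac)
qed

lemma state_nth_product:
  assumes "vertex_field A" and "vertex_field B"
  shows "nth_product A n B (- 1) vac = A n (B (- 1) vac)"
  using assms by (intro nth_product_vac) (auto simp: vertex_field_def)

lemma ex_vertex_field: "\<exists>A. vertex_field A \<and> A (- 1) vac = v"
proof (induction v rule: generating_induct)
  case subspace
  show ?case
  proof (rule subspaceI)
    show "0 \<in> {v. \<exists>A. vertex_field A \<and> A (- 1) vac = v}"
      using vertex_field_scale [OF vertex_field_vac, of 0] by force
    fix x y assume "x \<in> {v. \<exists>A. vertex_field A \<and> A (- 1) vac = v}"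
      "y \<in> {v. \<exists>A. vertex_field A \<and> A (- 1) vac = v}"
    then show "x + y \<in> {v. \<exists>A. vertex_field A \<and> A (- 1) vac = v}"
      using vertex_field_add by force
  next
    fix a x assume "x \<in> {v. \<exists>A. vertex_field A \<and> A (- 1) vac = v}"
    then show "scale a x \<in> {v. \<exists>A. vertex_field A \<and> A (- 1) vac = v}"
      using vertex_field_scale by force
  qed
next
  case vac
  show ?case using vertex_field_vac by force
next
  case (step A n v)
  then obtain B where B: "vertex_field B" "B (- 1) vac = v" by blast
  have "mutually_local A B" using B(1) step(1) by (rule vertex_field_local)
  then show ?case
    using vertex_field_nth_product [OF vertex_field_E [OF step(1)] B(1)]
      state_nth_product [OF vertex_field_E [OF step(1)] B(1)] B(2) by metis
qed

lemma vertex_field_unique: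
  assumes A: "vertex_field A" and B: "vertex_field B" and eq: "A (- 1) vac = B (- 1) vac"
  shows "A = B"
proof (intro ext)
  fix n v
  have "vertex_field (\<lambda>n v. A n v + scale (- 1) (B n v))"
    by (intro vertex_field_add vertex_field_scale A B)
  from vertex_field_eq_zero [OF this] eq show "A n v = B n v" by simp
qed

definition Y :: "'v \<Rightarrow> 'v formal_series"
  where "Y v = (THE A. vertex_field A \<and> A (- 1) vac = v)"

lemma Y_eqI: "vertex_field A \<Longrightarrow> A (- 1) vac = v \<Longrightarrow> Y v = A"
  unfolding Y_def using vertex_field_unique by blast

lemma Y_vertex_field: "vertex_field (Y v)" and Y_state: "Y v (- 1) vac = v"
  using ex_vertex_field [of v] Y_eqI by metis+

lemma Y_End: "Y v \<in> End_series scale" and Y_truncated: "truncated (Y v)"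
  and Y_creative: "n \<ge> 0 \<Longrightarrow> Y v n vac = 0" and Y_covariant: "covariant T (Y v)"
  using Y_vertex_field [of v] by (auto simp: vertex_field_def)

lemma Y_vac: "Y vac = (\<lambda>n w. if n = - 1 then w else 0)"
  by (rule Y_eqI [OF vertex_field_vac]) simp

lemma Y_add: "Y (u + v) = (\<lambda>n w. Y u n w + Y v n w)"
  by (rule Y_eqI) (simp_all add: vertex_field_add Y_vertex_field Y_state)

lemma Y_scale: "Y (scale a v) = (\<lambda>n w. scale a (Y v n w))"
  by (rule Y_eqI) (simp_all add: vertex_field_scale Y_vertex_field Y_state)

lemma Y_zero: "Y 0 n w = 0"
  using Y_scale [of 0 0] by simp

lemma Y_E: "A \<in> E \<Longrightarrow> Y (A (- 1) vac) = A"
  by (rule Y_eqI) (simp_all add: vertex_field_E)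

text \<open>
  Induction on how \<open>v\<close> is built up from the vacuum: the field of \<open>A\<^sub>n v\<close> is \<open>A\<^bsub>(n)\<^esub>Y(v)\<close>, to which Dong's
  lemma applies since \<open>C\<close> is local to \<open>A \<in> E\<close> by definition and to \<open>Y(v)\<close> by induction.
\<close>
lemma Y_local_vertex_field:
  assumes C: "vertex_field C"
  shows "mutually_local (Y v) C"
proof (induction v rule: generating_induct)
  have End: "C \<in> End_series scale" using C by (simp add: vertex_field_def)
  case subspace
  show ?case
  proof (rule subspaceI)
    show "0 \<in> {v. mutually_local (Y v) C}"
      by (auto simp: mutually_local_def commutator_def Y_zero End_simps End intro: exI [of _ 0])
  qed (simp_all add: Y_add Y_scale mutually_local_add mutually_local_scale End)
next
  case vac
  show ?case unfolding Y_vac mutually_local_def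
    by (rule exI [of _ 0]) (use C in \<open>auto simp: vertex_field_def commutator_def fun_eq_iff End_simps\<close>)
next
  case (step A n v)
  have A: "vertex_field A" using step(1) by (rule vertex_field_E)
  have AY: "mutually_local A (Y v)"
    using Y_vertex_field step(1) by (rule vertex_field_local)
  have "Y (A n v) = nth_product A n (Y v)"
    by (rule Y_eqI) (simp_all add: vertex_field_nth_product state_nth_product A AY Y_vertex_field Y_state)
  moreover have "mutually_local C (nth_product A n (Y v))"
    using A C mutually_local_sym [OF step(2)]
    by (intro dong Y_End Y_truncated AY vertex_field_local(1) [OF C step(1)])
      (auto simp: vertex_field_def)
  ultimately show ?case by (simp add: mutually_local_sym)
qed

lemma Y_local: "mutually_local (Y u) (Y v)"
  by (rule Y_local_vertex_field [OF Y_vertex_field])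

lemma Y_iterate: "Y (Y u n v) = nth_product (Y u) n (Y v)"
  by (rule Y_eqI) (simp_all add: vertex_field_nth_product state_nth_product Y_local Y_vertex_field Y_state)

text \<open>
  The relation \<open>[L\<^sub>0, L\<^bsub>-1\<^esub>] = L\<^bsub>-1\<^esub>\<close> holds because \<open>[L\<^sub>0, L\<^bsub>-1\<^esub>] - L\<^bsub>-1\<^esub>\<close> commutes with the modes of \<open>E\<close>
  and kills the vacuum.
\<close>
lemma L0_T: "L0 (T v) = T (L0 v) + T v"
proof (induction v rule: generating_induct)
  case subspace
  show ?case
    by (rule subspaceI)
      (simp_all add: endo_zero endo_add endo_scale L0_endo T scale_right_distrib algebra_simps)
next
  case vac
  show ?case by (simp add: L0_vac T_vac endo_zero L0_endo T)
next
  case (step A n v)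
  obtain d :: int where d: "\<And>n v. L0 (A n v) = A n (L0 v) + scale (of_int (d - n - 1)) (A n v)"
    using homogeneous_fieldD [OF hom [OF step(1)]] by blast
  have cov: "T (A n v) = A n (T v) - scale (of_int n) (A (n - 1) v)" for n v
    using vertex_field_E [OF step(1)] by (simp add: vertex_field_def covariantD)
  show ?case
    by (simp add: cov d endo_add endo_diff endo_scale L0_endo T step(2) End_simps E_End [OF step(1)]
        algebra_simps scale_left_distrib scale_left_diff_distrib)
qed

text \<open>
  The field \<open>[L\<^sub>0, A(z)] - z \<partial>\<^sub>z A(z)\<close> is again a vertex field; as its state is \<open>L\<^sub>0 A\<^bsub>-1\<^esub>\<^bold>1\<close>, uniqueness
  turns this into the grading property.  Its bracket with a homogeneous \<open>B\<close> is \<open>[L\<^sub>0, [A\<^sub>i, B\<^sub>k]]\<close> plus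
  a multiple of \<open>[A\<^sub>i, B\<^sub>k]\<close> whose factor depends only on \<open>i + k\<close>, and such a factor is harmless
  by \<open>delta_pow_map\<close>.
\<close>
lemma vertex_field_degree:
  assumes A: "vertex_field A"
  shows "vertex_field (\<lambda>n v. commutator L0 (A n) v + scale (of_int (n + 1)) (A n v))"
    (is "vertex_field ?A'")
proof -
  have End: "A \<in> End_series scale" and cov: "covariant T A" using A by (auto simp: vertex_field_def)
  have T_L0: "T (L0 v) = L0 (T v) - T v" for v
    by (simp add: L0_T)
  have "?A' \<in> End_series scale"
    unfolding End_series_def mem_Collect_eq endo_iff commutator_def
    by (simp add: End_simps End endo_add endo_scale L0_endo algebra_simps)
  moreover have "truncated ?A'"
    unfolding truncated_def
  proof
    fix v
    obtain M N where "\<forall>n\<ge>M. A n v = 0" "\<forall>n\<ge>N. A n (L0 v) = 0"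
      using A by (meson truncatedD vertex_field_def)
    then show "\<exists>N. \<forall>n\<ge>N. ?A' n v = 0"
      by (intro exI [of _ "max M N"]) (simp add: commutator_def endo_zero L0_endo)
  qed
  moreover have "\<forall>n\<ge>0. ?A' n vac = 0"
    using A by (simp add: vertex_field_def commutator_def L0_vac endo_zero L0_endo End_simps)
  moreover have "covariant T ?A'"
    unfolding covariant_def [of _ ?A']
    by (simp add: T_L0 commutator_def dz_def covariantD [OF cov] endo_add endo_diff endo_scale L0_endo T
        End_simps End algebra_simps scale_left_distrib scale_left_diff_distrib)
  moreover have "mutually_local ?A' B" if B: "B \<in> E" for B
  proof -
    obtain d :: int where d: "\<And>n v. L0 (B n v) = B n (L0 v) + scale (of_int (d - n - 1)) (B n v)"
      using homogeneous_fieldD [OF hom [OF B]] by blast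
    obtain N where N: "\<And>v. (delta ^^ N) (\<lambda>i k. commutator (A i) (B k) v) = (\<lambda>i k. 0)"
      using vertex_field_local(1) [OF A B] unfolding mutually_local_def by blast
    have "(delta ^^ N) (\<lambda>i k. commutator (?A' i) (B k) v) = (\<lambda>i k. 0)" for v
    proof -
      let ?f = "\<lambda>v i k. commutator (A i) (B k) v"
      have two: "scale 2 x = x + x" for x
        using scale_left_distrib [of 1 1 x] by simp
      have "(\<lambda>i k. commutator (?A' i) (B k) v) = (\<lambda>i k. L0 (?f v i k) + (- ?f (L0 v) i k +
          scale (of_int (i + k + (2 - d))) (?f v i k)))"
        by (intro ext) (simp add: commutator_def d two endo_add endo_diff endo_scale L0_endo End_simps End
            E_End [OF B] algebra_simps scale_left_distrib scale_left_diff_distrib)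
      moreover have "(delta ^^ N) (\<lambda>i k. L0 (?f v i k)) = (\<lambda>i k. 0)"
        using delta_pow_map [of "\<lambda>_. L0" N "?f v"] N by (simp add: endo_diff endo_zero L0_endo)
      moreover have "(delta ^^ N) (\<lambda>i k. - ?f (L0 v) i k) = (\<lambda>i k. 0)"
        using delta_pow_map [of "\<lambda>_. uminus" N "?f (L0 v)"] N by simp
      moreover have "(delta ^^ N) (\<lambda>i k. scale (of_int (i + k + (2 - d))) (?f v i k)) = (\<lambda>i k. 0)"
        using delta_pow_map [of "\<lambda>s. scale (of_int (s + (2 - d)))" N "?f v"] N
        by (simp add: scale_right_diff_distrib)
      ultimately show ?thesis by (simp only: delta_pow_add) simp
    qed
    then show ?thesis unfolding mutually_local_def by blast
  qed
  ultimately show ?thesis by (simp add: vertex_field_def)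
qed

lemma Y_L0: "Y (L0 v) = (\<lambda>n w. commutator L0 (Y v n) w + scale (of_int (n + 1)) (Y v n w))"
  by (rule Y_eqI [OF vertex_field_degree [OF Y_vertex_field]])
    (simp add: commutator_def Y_state L0_vac End_simps Y_End)

lemma graded_vertex_algebra_Y: "graded_vertex_algebra scale L0 Y vac T"
proof (intro graded_vertex_algebra.intro graded_vertex_algebra_axioms.intro)
  show "vector_space scale" by (rule vector_space_axioms)
  show "Vector_Spaces.linear scale scale (\<lambda>u. Y u n w)" for n w
    by (simp add: endo_iff Y_add Y_scale)
  show "commutator L0 (Y v n) w = Y (L0 v) n w + times_z (dz scale (Y v)) n w" for v n w
    by (simp add: Y_L0 times_z_def dz_def flip: scale_left_distrib)
  show "commutator T (Y v n) w = dz scale (Y v) n w" for v n w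
    using Y_covariant by (simp add: covariant_def)
  show "jacobi_identity scale Y"
    by (rule jacobi_if_iterate_and_local) (rule Y_End Y_truncated Y_zero Y_iterate Y_local)+
qed (simp_all add: L0 Y_End vac Y_vac Y_state Y_creative T T_vac)

text \<open>
  Each \<open>A \<in> E\<close> is a value of both maps, so by the Jacobi identity at \<open>m = 0\<close> both send \<open>A\<^sub>n v\<close> to the
  \<open>n\<close>-th product of \<open>A\<close> with the field of \<open>v\<close>.
\<close>
lemma graded_vertex_algebra_unique:
  assumes Y1: "graded_vertex_algebra scale L0 Y1 vac T" "\<forall>A\<in>E. \<exists>u. A = Y1 u"
    and Y2: "graded_vertex_algebra scale L0 Y2 vac T" "\<forall>A\<in>E. \<exists>u. A = Y2 u"
  shows "Y1 = Y2"
proof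
  interpret Y1: graded_vertex_algebra scale L0 Y1 vac T by (rule Y1)
  interpret Y2: graded_vertex_algebra scale L0 Y2 vac T by (rule Y2)
  fix v
  have "\<forall>n w. Y1 v n w = Y2 v n w"
  proof (induction v rule: generating_induct)
    case subspace
    show ?case
      by (rule subspaceI)
        (auto simp: endo_zero [OF Y1.Y_linear] endo_zero [OF Y2.Y_linear] endo_add [OF Y1.Y_linear]
          endo_add [OF Y2.Y_linear] endo_scale [OF Y1.Y_linear] endo_scale [OF Y2.Y_linear])
  next
    case vac
    show ?case by (simp add: Y1.vac_field Y2.vac_field)
  next
    case (step A n v)
    then have v: "Y1 v = Y2 v" by blast
    obtain a b where a: "A = Y1 a" and b: "A = Y2 b" using step(1) Y1(2) Y2(2) by blast
    show ?case
      using iterate_if_jacobi [OF Y1.jacobi, of a n v] iterate_if_jacobi [OF Y2.jacobi, of b n v]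
      by (simp flip: a b add: v)
  qed
  then show "Y1 v = Y2 v" by blast
qed

end

theorem theorem5p12:
  fixes scale :: "complex \<Rightarrow> 'v::ab_group_add \<Rightarrow> 'v"
    and L0 T :: "'v \<Rightarrow> 'v"
    and vac :: 'v
    and E :: "'v formal_series set"
  assumes "vector_space scale"
    and "grading_operator scale L0"
    and "\<And>A. A \<in> E \<Longrightarrow> homogeneous_field scale L0 A"
    and "vac \<in> homogeneous_component scale L0 0"
    and "\<And>A n. A \<in> E \<Longrightarrow> n \<ge> 0 \<Longrightarrow> A n vac = 0"
    and "endo scale T"
    and "T vac = 0"
    and "\<And>A n v. A \<in> E \<Longrightarrow> commutator T (A n) v = dz scale A n v"
    and "module.span scale (mode_monomials E vac) = UNIV"
    and "\<And>A B. A \<in> E \<Longrightarrow> B \<in> E \<Longrightarrow> local_fields scale A B"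
  shows "(\<exists>!Y. graded_vertex_algebra scale L0 Y vac T \<and> (\<forall>A\<in>E. \<exists>u. A = Y u)) \<and>
    (\<forall>Y L c.
       graded_vertex_algebra scale L0 Y vac T \<and> (\<forall>A\<in>E. \<exists>u. A = Y u) \<and>
       (\<forall>n. endo scale (L n)) \<and> L 0 = L0 \<and> L (- 1) = T \<and>
       (\<lambda>n. L (n - 1)) \<in> E \<and> virasoro_relation scale L c \<longrightarrow>
       (\<exists>conf. vertex_operator_algebra scale L0 Y vac T L c conf))"
proof (intro conjI allI impI)
  interpret vector_space scale by fact
  interpret generating_fields scale L0 T vac E
    by (intro generating_fields.intro generating_fields_axioms.intro complex_vector_space.intro
        vector_space_axioms) (fact assms)+
  have Y_range: "\<forall>A\<in>E. \<exists>u. A = Y u" using Y_E by metis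
  show "\<exists>!Y. graded_vertex_algebra scale L0 Y vac T \<and> (\<forall>A\<in>E. \<exists>u. A = Y u)"
  proof (rule ex1I)
    show "graded_vertex_algebra scale L0 Y vac T \<and> (\<forall>A\<in>E. \<exists>u. A = Y u)"
      using graded_vertex_algebra_Y Y_range by blast
    show "Y' = Y" if "graded_vertex_algebra scale L0 Y' vac T \<and> (\<forall>A\<in>E. \<exists>u. A = Y' u)" for Y'
      using graded_vertex_algebra_unique that graded_vertex_algebra_Y Y_range by blast
  qed
next
  fix Y L c
  assume asm: "graded_vertex_algebra scale L0 Y vac T \<and> (\<forall>A\<in>E. \<exists>u. A = Y u) \<and>
       (\<forall>n. endo scale (L n)) \<and> L 0 = L0 \<and> L (- 1) = T \<and>
       (\<lambda>n. L (n - 1)) \<in> E \<and> virasoro_relation scale L c"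
  then obtain conf where conf: "(\<lambda>n. L (n - 1)) = Y conf" by blast
  have "Y conf n = L (n - 1)" for n
    by (simp flip: conf)
  with asm have "vertex_operator_algebra scale L0 Y vac T L c conf"
    by (simp add: vertex_operator_algebra_def vertex_operator_algebra_axioms_def)
  then show "\<exists>conf. vertex_operator_algebra scale L0 Y vac T L c conf" ..
qed

end
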